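(* Let $\pi$ be an $n\times n$ partial involution and let $\mathcal C_\pi=\{B^t\pi B: B\in\mathbb B_n(\mathbb C)\}$. Then the Zariski closure $\overline{\mathcal C_\pi}$ (a subvariety of the space of complex symmetric $n\times n$ matrices) satisfies $$\dim\,\overline{\mathcal C_\pi}=\frac{n^2+n}{2}-\mathfrak D(\pi).$$
   Context: $\mathbb B_n(\mathbb C)$ is the group of invertible upper-triangular $n\times n$ complex matrices, acting on complex symmetric $n\times n$ matrices by congruence $S\mapsto B^tSB$. A partial involution is a symmetric $n\times n$ $(0,1)$-matrix with at most one $1$ in each row and each column. The rank-control matrix $R(\pi)=(r_{ij})_{1\le i,j\le n}$ has $r_{ij}$ equal to the rank of the upper-left $i\times j$ submatrix of $\pi$. Set additionally $r_{0k}=0$ for $0\le k<n$. Define $$\mathfrak D(\pi)=\#\{(i,j): 1\le i\le j\le n,\ r_{ij}=r_{i-1,j-1}\}.$$ *)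

theory Defs
  imports
    "HOL-Analysis.Abstract_Topology"
    "HOL-Library.Extended_Real"
    "Jordan_Normal_Form.DL_Rank"
begin

definition sym_mats :: "nat \<Rightarrow> complex mat set" where
  "sym_mats n = {A \<in> carrier_mat n n. transpose_mat A = A}"

definition borel_group :: "nat \<Rightarrow> complex mat set" where
  "borel_group n = {B \<in> carrier_mat n n. upper_triangular B \<and> invertible_mat B}"

definition congruence_orbit :: "nat \<Rightarrow> complex mat \<Rightarrow> complex mat set" where
  "congruence_orbit n S = {transpose_mat B * S * B | B. B \<in> borel_group n}"

definition partial_involution :: "nat \<Rightarrow> complex mat \<Rightarrow> bool" where
  "partial_involution n \<pi> \<longleftrightarrow>
     \<pi> \<in> sym_mats n \<and>
     (\<forall>i<n. \<forall>j<n. \<pi> $$ (i, j) = 0 \<or> \<pi> $$ (i, j) = 1) \<and>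
     (\<forall>i<n. card {j. j < n \<and> \<pi> $$ (i, j) = 1} \<le> 1) \<and>
     (\<forall>j<n. card {i. i < n \<and> \<pi> $$ (i, j) = 1} \<le> 1)"

(* The library's matrix entries are indexed from 0, but the arguments i, j here are sizes, so that
   they are the 1-based indices of the rank-control matrix. The row r_0k = 0 is part of the
   definition; the constant vec_space.rank takes the number of rows as its first argument. *)

definition rank_control :: "complex mat \<Rightarrow> nat \<Rightarrow> nat \<Rightarrow> nat" where
  "rank_control \<pi> i j =
     (if i = 0 then 0 else vec_space.rank i (mat i j (\<lambda>(k, l). \<pi> $$ (k, l))))"

definition diag_repeats :: "nat \<Rightarrow> complex mat \<Rightarrow> nat" where
  "diag_repeats n \<pi> =
     card {(i, j). 1 \<le> i \<and> i \<le> j \<and> j \<le> n \<and>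
                   rank_control \<pi> i j = rank_control \<pi> (i - 1) (j - 1)}"

(* Polynomials in the n^2 matrix entries, as functions. On symmetric matrices these restrict to
   exactly the polynomial functions in the entries on and above the diagonal. *)

inductive_set poly_funs :: "nat \<Rightarrow> (complex mat \<Rightarrow> complex) set" for n :: nat where
  const: "(\<lambda>A. c) \<in> poly_funs n"
| entry: "i < n \<Longrightarrow> j < n \<Longrightarrow> (\<lambda>A. A $$ (i, j)) \<in> poly_funs n"
| add: "f \<in> poly_funs n \<Longrightarrow> g \<in> poly_funs n \<Longrightarrow> (\<lambda>A. f A + g A) \<in> poly_funs n"
| mult: "f \<in> poly_funs n \<Longrightarrow> g \<in> poly_funs n \<Longrightarrow> (\<lambda>A. f A * g A) \<in> poly_funs n"

definition zero_locus :: "nat \<Rightarrow> (complex mat \<Rightarrow> complex) set \<Rightarrow> complex mat set" where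
  "zero_locus n F = {A \<in> sym_mats n. \<forall>f\<in>F. f A = 0}"

definition zariski_sym :: "nat \<Rightarrow> complex mat topology" where
  "zariski_sym n =
     topology (\<lambda>U. \<exists>F \<subseteq> poly_funs n. U = sym_mats n - zero_locus n F)"

lemma zero_locus_mult:
  "zero_locus n {(\<lambda>A. f A * g A) | f g. f \<in> F \<and> g \<in> G} = zero_locus n F \<union> zero_locus n G"
  (is "zero_locus n ?H = _")
proof (intro equalityI subsetI)
  fix A assume A: "A \<in> zero_locus n ?H"
  show "A \<in> zero_locus n F \<union> zero_locus n G"
  proof (rule ccontr)
    assume "A \<notin> zero_locus n F \<union> zero_locus n G"
    moreover have "A \<in> sym_mats n"
      using A by (simp add: zero_locus_def)
    ultimately obtain f g where fg: "f \<in> F" "f A \<noteq> 0" "g \<in> G" "g A \<noteq> 0"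
      by (auto simp: zero_locus_def)
    then have "(\<lambda>A. f A * g A) \<in> ?H"
      by blast
    then have "f A * g A = 0"
      by (rule bspec[OF A[unfolded zero_locus_def, THEN CollectD, THEN conjunct2]])
    then show False
      using fg by simp
  qed
qed (auto simp: zero_locus_def)

lemma istopology_zariski_sym:
  "istopology (\<lambda>U. \<exists>F \<subseteq> poly_funs n. U = sym_mats n - zero_locus n F)"
  unfolding istopology_def
proof (intro conjI allI impI)
  fix U V
  assume "\<exists>F \<subseteq> poly_funs n. U = sym_mats n - zero_locus n F"
    and "\<exists>F \<subseteq> poly_funs n. V = sym_mats n - zero_locus n F"
  then obtain F G where F: "F \<subseteq> poly_funs n" "U = sym_mats n - zero_locus n F"
    and G: "G \<subseteq> poly_funs n" "V = sym_mats n - zero_locus n G"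
    by (elim exE conjE)
  let ?H = "{(\<lambda>A. f A * g A) | f g. f \<in> F \<and> g \<in> G}"
  have "?H \<subseteq> poly_funs n"
    using F(1) G(1) by (auto intro!: poly_funs.mult)
  moreover have "U \<inter> V = sym_mats n - zero_locus n ?H"
    unfolding F(2) G(2) zero_locus_mult by (rule Diff_Un[symmetric])
  ultimately show "\<exists>F \<subseteq> poly_funs n. U \<inter> V = sym_mats n - zero_locus n F"
    by (intro exI[of _ ?H] conjI)
next
  fix \<K>
  assume "\<forall>K\<in>\<K>. \<exists>F \<subseteq> poly_funs n. K = sym_mats n - zero_locus n F"
  then have "\<exists>F. \<forall>K\<in>\<K>. F K \<subseteq> poly_funs n \<and> K = sym_mats n - zero_locus n (F K)"
    by (rule bchoice)
  then obtain F where F: "\<forall>K\<in>\<K>. F K \<subseteq> poly_funs n \<and> K = sym_mats n - zero_locus n (F K)"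
    by (elim exE)
  have F_sub: "F K \<subseteq> poly_funs n" and F_eq: "sym_mats n - zero_locus n (F K) = K" if "K \<in> \<K>" for K
    using bspec[OF F that] by simp_all
  have "(\<Union>K\<in>\<K>. F K) \<subseteq> poly_funs n"
    using F_sub by (rule UN_least)
  moreover have "\<Union>\<K> = sym_mats n - zero_locus n (\<Union>K\<in>\<K>. F K)"
  proof -
    have "sym_mats n - zero_locus n (\<Union>K\<in>\<K>. F K) = (\<Union>K\<in>\<K>. sym_mats n - zero_locus n (F K))"
      unfolding zero_locus_def by auto
    also have "\<dots> = \<Union>\<K>"
      using F_eq by simp
    finally show ?thesis ..
  qed
  ultimately show "\<exists>F \<subseteq> poly_funs n. \<Union>\<K> = sym_mats n - zero_locus n F"
    by (intro exI[of _ "\<Union>K\<in>\<K>. F K"] conjI)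
qed

lemma openin_zariski_sym:
  "openin (zariski_sym n) U \<longleftrightarrow> (\<exists>F \<subseteq> poly_funs n. U = sym_mats n - zero_locus n F)"
  unfolding zariski_sym_def topology_inverse'[OF istopology_zariski_sym] ..

lemma topspace_zariski_sym: "topspace (zariski_sym n) = sym_mats n"
proof
  show "topspace (zariski_sym n) \<subseteq> sym_mats n"
    unfolding topspace_def openin_zariski_sym by blast
  have "sym_mats n = sym_mats n - zero_locus n {\<lambda>A. 1}"
    by (auto simp: zero_locus_def)
  then have "openin (zariski_sym n) (sym_mats n)"
    unfolding openin_zariski_sym
    by (intro exI[of _ "{\<lambda>A. 1}"] conjI) (simp_all add: poly_funs.const)
  then show "sym_mats n \<subseteq> topspace (zariski_sym n)"
    by (rule openin_subset)
qed

lemma closedin_zariski_sym: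
  "closedin (zariski_sym n) Z \<longleftrightarrow> (\<exists>F \<subseteq> poly_funs n. Z = zero_locus n F)"
proof -
  have sub: "zero_locus n F \<subseteq> sym_mats n" for F
    by (auto simp: zero_locus_def)
  have "Z = zero_locus n F" if "Z \<subseteq> sym_mats n" "sym_mats n - Z = sym_mats n - zero_locus n F" for F
    using that sub[of F] by blast
  then show ?thesis
    unfolding closedin_def openin_zariski_sym topspace_zariski_sym using sub by metis
qed

definition irreducible_in :: "'a topology \<Rightarrow> 'a set \<Rightarrow> bool" where
  "irreducible_in X S \<longleftrightarrow>
     S \<subseteq> topspace X \<and> S \<noteq> {} \<and>
     (\<forall>Y Z. closedin X Y \<and> closedin X Z \<and> S \<subseteq> Y \<union> Z \<longrightarrow> S \<subseteq> Y \<or> S \<subseteq> Z)"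

(* Krull dimension: the supremum of the lengths d of chains Z_0 < ... < Z_d of irreducible closed
   subsets. The empty space gets dimension 0 here. *)

definition krull_dim :: "'a topology \<Rightarrow> enat" where
  "krull_dim X =
     Sup {enat d | d. \<exists>Z :: nat \<Rightarrow> 'a set.
            (\<forall>i\<le>d. closedin X (Z i) \<and> irreducible_in X (Z i)) \<and>
            (\<forall>i<d. Z i \<subset> Z (Suc i))}"

end

theory Submission
  imports Defs "HOL-Computational_Algebra.Polynomial"
begin

text \<open>Call a position \<open>(i, j)\<close> with \<open>i \<le> j\<close> essential if the rank-control matrix jumps there along the
  diagonal, i.e. if \<open>\<pi>\<close> has a one in row \<open>i\<close> weakly left of \<open>(i, j)\<close> or in column \<open>j\<close> weakly above it.
  The number \<open>d\<close> of essential positions is the claimed dimension.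

  For the upper bound, a chain \<open>Z 0 \<subset> \<dots> \<subset> Z m\<close> of irreducible closed sets yields polynomials
  \<open>f i\<close> vanishing on \<open>Z i\<close> but not on \<open>Z (i + 1)\<close>, and these are algebraically independent on \<open>Z m\<close>, hence
  on the orbit. On the orbit every matrix entry is a quotient of polynomials in the essential entries,
  because vanishing bordered minors determine the other entries. Counting the monomials in
  the \<open>f i\<close> with exponents below \<open>K\<close> and letting \<open>K\<close> grow gives \<open>m \<le> d\<close>.

  For the lower bound, the parameters of the Borel group are set to their values at the identity one after
  another, in an order compatible with the triangular shape of \<open>transpose_mat B * \<pi> * B\<close>. The
  closures of the images are irreducible, and they shrink strictly at every essential position, because the
  corresponding entry becomes constant.\<close>

section \<open>Algebraic independence and counting of monomials\<close>

text \<open>Gaussian elimination for a homogeneous system with equations \<open>B\<close> and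
  unknowns \<open>A\<close>: each induction step drops one equation and with it an unknown that
  occurs in it, if there is one.\<close>

lemma exists_nontrivial_solution:
  fixes c :: "'a \<Rightarrow> 'b \<Rightarrow> 'k::field"
  assumes "finite B" "finite A" "card B < card A"
  shows "\<exists>x. (\<exists>a\<in>A. x a \<noteq> 0) \<and> (\<forall>b\<in>B. (\<Sum>a\<in>A. x a * c a b) = 0)"
  using assms
proof (induction B arbitrary: A c rule: finite_induct)
  case empty
  then have "A \<noteq> {}" by auto
  then show ?case by (intro exI[of _ "\<lambda>_. 1"]) auto
next
  case (insert b B)
  show ?case
  proof (cases "\<forall>a\<in>A. c a b = 0")
    case True
    have "card B < card A" using insert by simp
    from insert.IH[OF insert.prems(1) this, of c] obtain x
      where x: "\<exists>a\<in>A. x a \<noteq> 0" "\<forall>b\<in>B. (\<Sum>a\<in>A. x a * c a b) = 0" by blast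
    then show ?thesis using True by (intro exI[of _ x]) auto
  next
    case False
    then obtain a0 where a0: "a0 \<in> A" "c a0 b \<noteq> 0" by blast
    let ?A = "A - {a0}"
    have "card B < card ?A" using insert a0 by simp
    \<comment> \<open>These coefficients are what remains after equation \<open>b\<close> has been
      solved for the unknown \<open>a0\<close>.\<close>
    from insert.IH[OF _ this, of "\<lambda>a b'. c a b' - c a b / c a0 b * c a0 b'"] insert.prems(1)
    obtain x where x: "\<exists>a\<in>?A. x a \<noteq> 0"
      "\<forall>b'\<in>B. (\<Sum>a\<in>?A. x a * (c a b' - c a b / c a0 b * c a0 b')) = 0" by auto
    define y where "y = x(a0 := - (\<Sum>a\<in>?A. x a * c a b) / c a0 b)"
    have split: "(\<Sum>a\<in>A. y a * c a b') = y a0 * c a0 b' + (\<Sum>a\<in>?A. x a * c a b')" for b'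
    proof -
      have "(\<Sum>a\<in>?A. y a * c a b') = (\<Sum>a\<in>?A. x a * c a b')"
        by (rule sum.cong) (auto simp: y_def)
      then show ?thesis using a0 insert.prems(1) by (simp add: sum.remove)
    qed
    have "(\<Sum>a\<in>A. y a * c a b') = 0" if "b' \<in> insert b B" for b'
    proof (cases "b' = b")
      case True
      then show ?thesis using a0 unfolding split by (simp add: y_def)
    next
      case False
      then have "0 = (\<Sum>a\<in>?A. x a * (c a b' - c a b / c a0 b * c a0 b'))" using x that by auto
      also have "\<dots> = (\<Sum>a\<in>?A. x a * c a b') - (\<Sum>a\<in>?A. x a * c a b) / c a0 b * c a0 b'"
        by (simp add: right_diff_distrib sum_subtractf sum_distrib_right sum_divide_distrib mult.assoc)
      also have "\<dots> = (\<Sum>a\<in>A. y a * c a b')"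
        unfolding split by (simp add: y_def)
      finally show ?thesis by simp
    qed
    moreover have "\<exists>a\<in>A. y a \<noteq> 0" using x(1) by (auto simp: y_def)
    ultimately show ?thesis by blast
  qed
qed

definition monomial_fun :: "'i set \<Rightarrow> ('i \<Rightarrow> 'x \<Rightarrow> 'k::field) \<Rightarrow> ('i \<Rightarrow> nat) \<Rightarrow> 'x \<Rightarrow> 'k" where
  "monomial_fun I f a x = (\<Prod>i\<in>I. f i x ^ a i)"

text \<open>Each exponent is bounded on its own, rather than the total degree, so that the number of
  monomials is a plain power.\<close>

definition exponents :: "'i set \<Rightarrow> nat \<Rightarrow> ('i \<Rightarrow> nat) set" where
  "exponents I N = PiE I (\<lambda>_. {..<N})"

lemma finite_exponents: "finite I \<Longrightarrow> finite (exponents I N)"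
  by (simp add: exponents_def finite_PiE)

lemma card_exponents: "finite I \<Longrightarrow> card (exponents I N) = N ^ card I"
  by (simp add: exponents_def card_PiE)

text \<open>Independence concerns the restrictions to \<open>X\<close>. Every polynomial fits into a
  box of exponents below some \<open>K\<close>, so quantifying over \<open>K\<close> covers all
  relations.\<close>

definition alg_indep_on :: "'x set \<Rightarrow> 'i set \<Rightarrow> ('i \<Rightarrow> 'x \<Rightarrow> 'k::field) \<Rightarrow> bool" where
  "alg_indep_on X I f \<longleftrightarrow> (\<forall>K c.
     (\<forall>x\<in>X. (\<Sum>a\<in>exponents I K. c a * monomial_fun I f a x) = 0) \<longrightarrow> (\<forall>a\<in>exponents I K. c a = 0))"

section \<open>Quotients of polynomials in finitely many coordinates\<close>

locale coordinates =
  fixes X :: "'x set" and E :: "'e set" and u :: "'e \<Rightarrow> 'x \<Rightarrow> 'k::field"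
  assumes finite_E: "finite E"
begin

definition polys :: "nat \<Rightarrow> ('x \<Rightarrow> 'k) set" where
  "polys N = {f. \<exists>c. \<forall>x\<in>X. f x = (\<Sum>a\<in>exponents E (Suc N). c a * monomial_fun E u a x)}"

lemma polys_cong: "f \<in> polys N \<Longrightarrow> (\<And>x. x \<in> X \<Longrightarrow> f x = g x) \<Longrightarrow> g \<in> polys N"
  unfolding polys_def by auto

lemma polys_add:
  assumes "f \<in> polys N" "g \<in> polys N"
  shows "(\<lambda>x. f x + g x) \<in> polys N"
proof -
  obtain c d where
    "\<forall>x\<in>X. f x = (\<Sum>a\<in>exponents E (Suc N). c a * monomial_fun E u a x)"
    "\<forall>x\<in>X. g x = (\<Sum>a\<in>exponents E (Suc N). d a * monomial_fun E u a x)"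
    using assms unfolding polys_def by blast
  then show ?thesis unfolding polys_def
    by (intro CollectI exI[of _ "\<lambda>a. c a + d a"]) (simp add: distrib_right sum.distrib)
qed

lemma polys_scale:
  assumes "f \<in> polys N"
  shows "(\<lambda>x. r * f x) \<in> polys N"
proof -
  obtain c where "\<forall>x\<in>X. f x = (\<Sum>a\<in>exponents E (Suc N). c a * monomial_fun E u a x)"
    using assms unfolding polys_def by blast
  then show ?thesis unfolding polys_def
    by (intro CollectI exI[of _ "\<lambda>a. r * c a"]) (simp add: mult.assoc sum_distrib_left)
qed

lemma polys_zero: "(\<lambda>x. 0) \<in> polys N"
  unfolding polys_def by (intro CollectI exI[of _ "\<lambda>_. 0"]) simp

lemma polys_sum: "(\<And>s. s \<in> S \<Longrightarrow> f s \<in> polys N) \<Longrightarrow> (\<lambda>x. \<Sum>s\<in>S. f s x) \<in> polys N"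
  by (induction S rule: infinite_finite_induct) (auto intro: polys_zero polys_add)

lemma monomial_fun_cong: "(\<And>i. i \<in> I \<Longrightarrow> a i = b i) \<Longrightarrow> monomial_fun I f a x = monomial_fun I f b x"
  unfolding monomial_fun_def by (rule prod.cong) auto

lemma monomial_in_polys:
  assumes "\<And>e. e \<in> E \<Longrightarrow> a e \<le> N"
  shows "monomial_fun E u a \<in> polys N"
proof -
  let ?b = "restrict a E"
  have b: "?b \<in> exponents E (Suc N)" using assms by (auto simp: exponents_def less_Suc_eq_le)
  have "monomial_fun E u a x = (\<Sum>b'\<in>exponents E (Suc N). (if b' = ?b then 1 else 0) * monomial_fun E u b' x)" for x
  proof -
    have "(\<Sum>b'\<in>exponents E (Suc N). (if b' = ?b then 1 else 0) * monomial_fun E u b' x)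
        = (\<Sum>b'\<in>exponents E (Suc N). if b' = ?b then monomial_fun E u b' x else 0)"
      by (rule sum.cong) auto
    also have "\<dots> = monomial_fun E u ?b x"
      using b finite_exponents[OF finite_E] by simp
    also have "\<dots> = monomial_fun E u a x" by (rule monomial_fun_cong) simp
    finally show ?thesis ..
  qed
  then show ?thesis unfolding polys_def
    by (intro CollectI exI[of _ "\<lambda>b'. if b' = ?b then 1 else 0"]) blast
qed

lemma polys_mult:
  assumes "f \<in> polys N" "g \<in> polys M"
  shows "(\<lambda>x. f x * g x) \<in> polys (N + M)"
proof -
  obtain c d where cd:
    "\<forall>x\<in>X. f x = (\<Sum>a\<in>exponents E (Suc N). c a * monomial_fun E u a x)"
    "\<forall>x\<in>X. g x = (\<Sum>b\<in>exponents E (Suc M). d b * monomial_fun E u b x)"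
    using assms unfolding polys_def by blast
  have mm: "monomial_fun E u a x * monomial_fun E u b x = monomial_fun E u (\<lambda>e. a e + b e) x" for a b x
    by (simp add: monomial_fun_def power_add prod.distrib)
  have "(\<lambda>x. \<Sum>a\<in>exponents E (Suc N). \<Sum>b\<in>exponents E (Suc M).
          (c a * d b) * monomial_fun E u (\<lambda>e. a e + b e) x) \<in> polys (N + M)"
    by (intro polys_sum polys_scale monomial_in_polys) (fastforce simp: exponents_def PiE_def Pi_def less_Suc_eq_le intro: add_mono)
  then show ?thesis
    by (rule polys_cong) (simp add: cd mm[symmetric] sum_product mult_ac)
qed

lemma polys_one: "(\<lambda>x. 1) \<in> polys N"
  using monomial_in_polys[of "\<lambda>_. 0" N] by (simp add: monomial_fun_def[abs_def])

lemma polys_const: "(\<lambda>x. r) \<in> polys N"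
  using polys_scale[OF polys_one, of r] by simp

lemma polys_mono: "f \<in> polys N \<Longrightarrow> N \<le> M \<Longrightarrow> f \<in> polys M"
  using polys_mult[OF _ polys_one[of "M - N"], of f N] by simp

lemma polys_coord:
  assumes "e \<in> E"
  shows "u e \<in> polys 1"
proof -
  have "monomial_fun E u (\<lambda>e'. if e' = e then 1 else 0) \<in> polys 1"
    by (rule monomial_in_polys) simp
  moreover have "monomial_fun E u (\<lambda>e'. if e' = e then 1 else 0) x = u e x" for x
  proof -
    have "monomial_fun E u (\<lambda>e'. if e' = e then 1 else 0) x = (\<Prod>e'\<in>E. if e' = e then u e' x else 1)"
      unfolding monomial_fun_def by (rule prod.cong) auto
    then show ?thesis using assms finite_E by simp
  qed
  ultimately show ?thesis by (rule polys_cong)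
qed

lemma polys_power: "f \<in> polys N \<Longrightarrow> (\<lambda>x. f x ^ k) \<in> polys (N * k)"
proof (induction k)
  case 0
  then show ?case by (simp add: polys_one)
next
  case (Suc k)
  then show ?case using polys_mult[of f N "\<lambda>x. f x ^ k" "N * k"] by (simp add: mult.commute)
qed

lemma polys_prod:
  "finite I \<Longrightarrow> (\<And>i. i \<in> I \<Longrightarrow> f i \<in> polys N) \<Longrightarrow> (\<lambda>x. \<Prod>i\<in>I. f i x) \<in> polys (N * card I)"
proof (induction I rule: finite_induct)
  case empty
  then show ?case by (simp add: polys_one)
next
  case (insert i I)
  then show ?case using polys_mult[of "f i" N "\<lambda>x. \<Prod>i\<in>I. f i x" "N * card I"] by simp
qed

text \<open>Denominators have no zero on the whole of \<open>X\<close>, so that these functions form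
  a ring in which nowhere vanishing functions can be inverted.\<close>

definition regular :: "('x \<Rightarrow> 'k) set" where
  "regular = {f. \<exists>N p q. p \<in> polys N \<and> q \<in> polys N \<and> (\<forall>x\<in>X. q x \<noteq> 0 \<and> f x = p x / q x)}"

lemma regularI:
  "p \<in> polys N \<Longrightarrow> q \<in> polys N \<Longrightarrow> (\<And>x. x \<in> X \<Longrightarrow> q x \<noteq> 0) \<Longrightarrow> (\<And>x. x \<in> X \<Longrightarrow> f x = p x / q x)
    \<Longrightarrow> f \<in> regular"
  unfolding regular_def by blast

lemma regular_cong: "f \<in> regular \<Longrightarrow> (\<And>x. x \<in> X \<Longrightarrow> f x = g x) \<Longrightarrow> g \<in> regular"
  unfolding regular_def by fastforce

lemma polys_regular: "f \<in> polys N \<Longrightarrow> f \<in> regular"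
  by (rule regularI[OF _ polys_one]) auto

lemma regular_const: "(\<lambda>x. r) \<in> regular"
  by (rule polys_regular[OF polys_const])

lemma regular_coord: "e \<in> E \<Longrightarrow> u e \<in> regular"
  by (rule polys_regular[OF polys_coord])

lemma regular_add:
  assumes "f \<in> regular" "g \<in> regular"
  shows "(\<lambda>x. f x + g x) \<in> regular"
proof -
  obtain p N q where 1: "p \<in> polys N" "q \<in> polys N" "\<And>x. x \<in> X \<Longrightarrow> q x \<noteq> 0" "\<And>x. x \<in> X \<Longrightarrow> f x = p x / q x"
    using assms(1) unfolding regular_def by auto
  obtain p' M q' where 2: "p' \<in> polys M" "q' \<in> polys M" "\<And>x. x \<in> X \<Longrightarrow> q' x \<noteq> 0" "\<And>x. x \<in> X \<Longrightarrow> g x = p' x / q' x"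
    using assms(2) unfolding regular_def by auto
  have "(\<lambda>x. p x * q' x + q x * p' x) \<in> polys (N + M)"
    by (intro polys_add polys_mult 1 2)
  moreover have "(\<lambda>x. q x * q' x) \<in> polys (N + M)"
    by (intro polys_mult 1 2)
  ultimately show ?thesis
    by (rule regularI) (simp_all add: 1 2 field_simps)
qed

lemma regular_mult:
  assumes "f \<in> regular" "g \<in> regular"
  shows "(\<lambda>x. f x * g x) \<in> regular"
proof -
  obtain p N q where 1: "p \<in> polys N" "q \<in> polys N" "\<And>x. x \<in> X \<Longrightarrow> q x \<noteq> 0" "\<And>x. x \<in> X \<Longrightarrow> f x = p x / q x"
    using assms(1) unfolding regular_def by auto
  obtain p' M q' where 2: "p' \<in> polys M" "q' \<in> polys M" "\<And>x. x \<in> X \<Longrightarrow> q' x \<noteq> 0" "\<And>x. x \<in> X \<Longrightarrow> g x = p' x / q' x"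
    using assms(2) unfolding regular_def by auto
  have "(\<lambda>x. p x * p' x) \<in> polys (N + M)" "(\<lambda>x. q x * q' x) \<in> polys (N + M)"
    by (intro polys_mult 1 2)+
  then show ?thesis
    by (rule regularI) (simp_all add: 1 2 field_simps)
qed

lemma regular_divide:
  assumes "f \<in> regular" "g \<in> regular" "\<And>x. x \<in> X \<Longrightarrow> g x \<noteq> 0"
  shows "(\<lambda>x. f x / g x) \<in> regular"
proof -
  obtain p N q where 1: "p \<in> polys N" "q \<in> polys N" "\<And>x. x \<in> X \<Longrightarrow> q x \<noteq> 0" "\<And>x. x \<in> X \<Longrightarrow> g x = p x / q x"
    using assms(2) unfolding regular_def by auto
  \<comment> \<open>A function without zeros has a numerator without zeros, so its reciprocal is
    regular too.\<close>
  have "p x \<noteq> 0" if "x \<in> X" for x using 1(4) assms(3) that by fastforce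
  then have "(\<lambda>x. q x / p x) \<in> regular"
    by (intro regularI[OF 1(2,1)]) auto
  from regular_mult[OF assms(1) this] show ?thesis
    by (rule regular_cong) (simp add: 1)
qed

lemma regular_sum: "(\<And>s. s \<in> S \<Longrightarrow> f s \<in> regular) \<Longrightarrow> (\<lambda>x. \<Sum>s\<in>S. f s x) \<in> regular"
  by (induction S rule: infinite_finite_induct) (auto intro: regular_const regular_add)

lemma regular_prod: "(\<And>s. s \<in> S \<Longrightarrow> f s \<in> regular) \<Longrightarrow> (\<lambda>x. \<Prod>s\<in>S. f s x) \<in> regular"
  by (induction S rule: infinite_finite_induct) (auto intro: regular_const regular_mult)

text \<open>Counting monomials needs one degree bound for the whole family; the sum of the
  individual bounds serves.\<close>

lemma regular_common_degree:
  assumes "finite I" "\<And>i. i \<in> I \<Longrightarrow> f i \<in> regular"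
  obtains p N q where "\<And>i. i \<in> I \<Longrightarrow> p i \<in> polys N" "\<And>i. i \<in> I \<Longrightarrow> q i \<in> polys N"
    "\<And>i x. i \<in> I \<Longrightarrow> x \<in> X \<Longrightarrow> q i x \<noteq> 0 \<and> f i x = p i x / q i x"
proof -
  have "\<forall>i\<in>I. \<exists>w. fst (snd w) \<in> polys (fst w) \<and> snd (snd w) \<in> polys (fst w)
     \<and> (\<forall>x\<in>X. snd (snd w) x \<noteq> 0 \<and> f i x = fst (snd w) x / snd (snd w) x)"
    using assms(2) unfolding regular_def by fastforce
  then obtain w where w: "\<And>i. i \<in> I \<Longrightarrow> fst (snd (w i)) \<in> polys (fst (w i)) \<and> snd (snd (w i)) \<in> polys (fst (w i))
     \<and> (\<forall>x\<in>X. snd (snd (w i)) x \<noteq> 0 \<and> f i x = fst (snd (w i)) x / snd (snd (w i)) x)"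
    using bchoice by metis
  have "fst (w i) \<le> (\<Sum>i\<in>I. fst (w i))" if "i \<in> I" for i
    using assms(1) that by (intro member_le_sum) auto
  with w show ?thesis
    by (intro that[of "\<lambda>i. fst (snd (w i))" "\<Sum>i\<in>I. fst (w i)" "\<lambda>i. snd (snd (w i))"])
       (auto intro: polys_mono)
qed

text \<open>Clearing denominators puts the \<open>K ^ card I\<close> independent monomials with exponents below \<open>K\<close>
  into the span of at most \<open>(N * card I * K + 1) ^ card E\<close> monomials in the coordinates.\<close>

lemma alg_indep_card_le:
  assumes I: "finite I" and f: "\<And>i. i \<in> I \<Longrightarrow> f i \<in> regular" and indep: "alg_indep_on X I f"
  shows "card I \<le> card E"
proof -
  obtain p N q where p: "\<And>i. i \<in> I \<Longrightarrow> p i \<in> polys N" and q: "\<And>i. i \<in> I \<Longrightarrow> q i \<in> polys N"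
    and fpq: "\<And>i x. i \<in> I \<Longrightarrow> x \<in> X \<Longrightarrow> q i x \<noteq> 0 \<and> f i x = p i x / q i x"
    using regular_common_degree[where f = f, OF I f] by (metis (no_types, lifting))
  let ?m = "card I" and ?d = "card E"
  have count: "K ^ ?m \<le> (N * K * ?m + 1) ^ ?d" for K
  proof (rule ccontr)
    assume "\<not> K ^ ?m \<le> (N * K * ?m + 1) ^ ?d"
    then have less: "card (exponents E (Suc (N * K * ?m))) < card (exponents I K)"
      by (simp add: card_exponents I finite_E)
    \<comment> \<open>\<open>D\<close> is a common denominator of all monomials in the
      \<open>f i\<close> with exponents below \<open>K\<close>.\<close>
    define D where "D x = (\<Prod>i\<in>I. q i x ^ K)" for x
    have "(\<lambda>x. D x * monomial_fun I f a x) \<in> polys (N * K * ?m)" if a: "a \<in> exponents I K" for a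
    proof -
      have aK: "a i < K" if "i \<in> I" for i using a that by (auto simp: exponents_def)
      have "(\<lambda>x. p i x ^ a i * q i x ^ (K - a i)) \<in> polys (N * K)" if "i \<in> I" for i
        using polys_mult[OF polys_power[OF p[OF that], of "a i"] polys_power[OF q[OF that], of "K - a i"]]
          aK[OF that] by (simp add: add_mult_distrib2[symmetric])
      then have "(\<lambda>x. \<Prod>i\<in>I. p i x ^ a i * q i x ^ (K - a i)) \<in> polys (N * K * ?m)"
        by (rule polys_prod[OF I])
      then show ?thesis
      proof (rule polys_cong)
        fix x assume x: "x \<in> X"
        have "(\<Prod>i\<in>I. p i x ^ a i * q i x ^ (K - a i)) = (\<Prod>i\<in>I. q i x ^ K * f i x ^ a i)"
        proof (rule prod.cong)
          fix i assume i: "i \<in> I"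
          have "q i x ^ K = q i x ^ (K - a i) * q i x ^ a i"
            using aK[OF i] by (simp flip: power_add)
          then show "p i x ^ a i * q i x ^ (K - a i) = q i x ^ K * f i x ^ a i"
            using fpq[OF i x] by (simp add: power_divide)
        qed simp
        then show "(\<Prod>i\<in>I. p i x ^ a i * q i x ^ (K - a i)) = D x * monomial_fun I f a x"
          by (simp add: D_def monomial_fun_def prod.distrib)
      qed
    qed
    then have "\<forall>a. \<exists>c. a \<in> exponents I K \<longrightarrow> (\<forall>x\<in>X. D x * monomial_fun I f a x =
        (\<Sum>b\<in>exponents E (Suc (N * K * ?m)). c b * monomial_fun E u b x))"
      unfolding polys_def by blast
    then obtain c where c: "\<And>a x. a \<in> exponents I K \<Longrightarrow> x \<in> X \<Longrightarrow> D x * monomial_fun I f a x =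
        (\<Sum>b\<in>exponents E (Suc (N * K * ?m)). c a b * monomial_fun E u b x)"
      by metis
    obtain z where z: "\<exists>a\<in>exponents I K. z a \<noteq> 0"
      "\<forall>b\<in>exponents E (Suc (N * K * ?m)). (\<Sum>a\<in>exponents I K. z a * c a b) = 0"
      using exists_nontrivial_solution[OF finite_exponents[OF finite_E] finite_exponents[OF I] less, of c]
      by blast
    have "(\<Sum>a\<in>exponents I K. z a * monomial_fun I f a x) = 0" if x: "x \<in> X" for x
    proof -
      have "D x * (\<Sum>a\<in>exponents I K. z a * monomial_fun I f a x)
          = (\<Sum>a\<in>exponents I K. z a * (D x * monomial_fun I f a x))"
        by (simp add: sum_distrib_left mult_ac)
      also have "\<dots> = (\<Sum>a\<in>exponents I K. \<Sum>b\<in>exponents E (Suc (N * K * ?m)). z a * c a b * monomial_fun E u b x)"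
        by (rule sum.cong) (simp_all add: c x sum_distrib_left mult.assoc)
      also have "\<dots> = (\<Sum>b\<in>exponents E (Suc (N * K * ?m)). (\<Sum>a\<in>exponents I K. z a * c a b) * monomial_fun E u b x)"
        by (subst sum.swap) (simp add: sum_distrib_right)
      also have "\<dots> = 0" using z(2) by simp
      finally show ?thesis using fpq x I by (simp add: D_def)
    qed
    then show False using indep z(1) unfolding alg_indep_on_def by blast
  qed
  show ?thesis
  proof (rule ccontr)
    assume "\<not> ?m \<le> ?d"
    \<comment> \<open>With this \<open>b\<close>, the base \<open>N * K * ?m + 1\<close> is at most
      \<open>b * K\<close>, so the count would force
      \<open>K ^ (?d + 1) \<le> b ^ ?d * K ^ ?d\<close>. The value of \<open>K\<close> is chosen
      just too large for that.\<close>
    define b where "b = N * ?m + 1"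
    define K where "K = b ^ ?d + 1"
    have "K ^ (?d + 1) \<le> K ^ ?m" using \<open>\<not> ?m \<le> ?d\<close> by (intro power_increasing) (auto simp: K_def)
    also have "\<dots> \<le> (N * K * ?m + 1) ^ ?d" by (rule count)
    also have "\<dots> \<le> (b * K) ^ ?d"
      by (intro power_mono) (auto simp: b_def K_def algebra_simps)
    also have "\<dots> = b ^ ?d * K ^ ?d" by (simp add: power_mult_distrib)
    finally have "K \<le> b ^ ?d" by (simp add: K_def)
    then show False by (simp add: K_def)
  qed
qed

end

text \<open>The Leibniz formula expresses a determinant as a polynomial in its entries.\<close>

lemma (in coordinates) regular_det:
  assumes "\<And>p q. p < k \<Longrightarrow> q < k \<Longrightarrow> (\<lambda>x. F x p q) \<in> regular"
  shows "(\<lambda>x. det (mat k k (\<lambda>(p, q). F x p q))) \<in> regular"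
proof -
  have "(\<lambda>x. \<Sum>p | p permutes {0..<k}. signof p * (\<Prod>i = 0..<k. F x i (p i))) \<in> regular"
    by (intro regular_sum regular_mult regular_const regular_prod assms)
       (auto dest: permutes_in_image)
  then show ?thesis
  proof (rule regular_cong)
    fix x
    have "(\<Prod>i = 0..<k. F x i (p i)) = (\<Prod>i = 0..<k. mat k k (\<lambda>(p, q). F x p q) $$ (i, p i))"
      if "p permutes {0..<k}" for p
      by (rule prod.cong) (use permutes_in_image[OF that] in auto)
    then show "(\<Sum>p | p permutes {0..<k}. signof p * (\<Prod>i = 0..<k. F x i (p i)))
        = det (mat k k (\<lambda>(p, q). F x p q))"
      by (subst det_def'[of _ k]) (auto intro!: sum.cong)
  qed
qed

section \<open>Chains of irreducible closed sets\<close>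

lemma poly_funs_sum: "(\<And>s. s \<in> S \<Longrightarrow> f s \<in> poly_funs n) \<Longrightarrow> (\<lambda>A. \<Sum>s\<in>S. f s A) \<in> poly_funs n"
  by (induction S rule: infinite_finite_induct) (auto intro: poly_funs.intros)

lemma poly_funs_prod: "(\<And>s. s \<in> S \<Longrightarrow> f s \<in> poly_funs n) \<Longrightarrow> (\<lambda>A. \<Prod>s\<in>S. f s A) \<in> poly_funs n"
  by (induction S rule: infinite_finite_induct) (auto intro: poly_funs.intros)

lemma poly_funs_power: "f \<in> poly_funs n \<Longrightarrow> (\<lambda>A. f A ^ k) \<in> poly_funs n"
  by (induction k) (auto intro: poly_funs.intros)

lemma poly_funs_monomial_fun:
  "(\<And>i. i \<in> I \<Longrightarrow> f i \<in> poly_funs n) \<Longrightarrow> monomial_fun I f a \<in> poly_funs n"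
  unfolding monomial_fun_def[abs_def] by (intro poly_funs_prod poly_funs_power)

lemma closedin_vanishing:
  assumes "f \<in> poly_funs n"
  shows "closedin (zariski_sym n) {A \<in> sym_mats n. f A = 0}"
  unfolding closedin_zariski_sym zero_locus_def using assms by (intro exI[of _ "{f}"]) auto

lemma vanishing_on_closure:
  assumes "C \<subseteq> sym_mats n" "f \<in> poly_funs n" "\<And>A. A \<in> C \<Longrightarrow> f A = 0"
    and "A \<in> zariski_sym n closure_of C"
  shows "f A = 0"
proof -
  have "zariski_sym n closure_of C \<subseteq> {A \<in> sym_mats n. f A = 0}"
    using assms(1,3) by (intro closure_of_minimal closedin_vanishing[OF assms(2)]) blast
  then show ?thesis using assms(4) by auto
qed

lemma closedin_separate:
  assumes "closedin (zariski_sym n) Y" "A \<in> sym_mats n" "A \<notin> Y"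
  obtains f where "f \<in> poly_funs n" "\<And>B. B \<in> Y \<Longrightarrow> f B = 0" "f A \<noteq> 0"
proof -
  obtain F where F: "F \<subseteq> poly_funs n" "Y = zero_locus n F"
    using assms(1) unfolding closedin_zariski_sym by blast
  then obtain f where "f \<in> F" "f A \<noteq> 0"
    using assms(2,3) by (auto simp: zero_locus_def)
  then show thesis using F by (intro that[of f]) (auto simp: zero_locus_def)
qed

text \<open>The zero sets of \<open>f\<close> and \<open>g\<close> are closed and cover
  \<open>Z\<close>, so one of them contains it. In other words, the vanishing ideal of an
  irreducible set is prime.\<close>

lemma irreducible_in_zariski_domain:
  assumes Z: "irreducible_in (zariski_sym n) Z" and "f \<in> poly_funs n" "g \<in> poly_funs n"
    and "\<And>A. A \<in> Z \<Longrightarrow> f A * g A = 0"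
  shows "(\<forall>A\<in>Z. f A = 0) \<or> (\<forall>A\<in>Z. g A = 0)"
proof -
  have "Z \<subseteq> sym_mats n" using Z by (simp add: irreducible_in_def topspace_zariski_sym)
  then have "Z \<subseteq> {A \<in> sym_mats n. f A = 0} \<union> {A \<in> sym_mats n. g A = 0}" using assms(4) by auto
  then have "Z \<subseteq> {A \<in> sym_mats n. f A = 0} \<or> Z \<subseteq> {A \<in> sym_mats n. g A = 0}"
    using Z closedin_vanishing[OF assms(2)] closedin_vanishing[OF assms(3)]
    unfolding irreducible_in_def by meson
  then show ?thesis by auto
qed

text \<open>On \<open>Z\<close> the relation reduces to its term \<open>g 0\<close>, which therefore
  vanishes identically. The remaining sum has a factor \<open>f\<close>, which can be cancelled on
  the irreducible set \<open>Z'\<close>; repeating this kills every coefficient.\<close>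

lemma irreducible_power_relation:
  assumes Z': "irreducible_in (zariski_sym n) Z'" and sub: "Z \<subseteq> Z'"
    and f: "f \<in> poly_funs n" "\<And>A. A \<in> Z \<Longrightarrow> f A = 0" "\<exists>A\<in>Z'. f A \<noteq> 0"
  shows "(\<And>k. k < K \<Longrightarrow> g k \<in> poly_funs n) \<Longrightarrow>
    (\<And>k. k < K \<Longrightarrow> (\<forall>A\<in>Z. g k A = 0) \<Longrightarrow> (\<forall>A. g k A = 0)) \<Longrightarrow>
    (\<And>A. A \<in> Z' \<Longrightarrow> (\<Sum>k<K. g k A * f A ^ k) = 0) \<Longrightarrow> k < K \<Longrightarrow> g k A = 0"
proof (induction K arbitrary: g k A)
  case 0
  show ?case using "0.prems"(4) by simp
next
  case (Suc K)
  have split: "(\<Sum>k<Suc K. g k A * f A ^ k) = g 0 A + f A * (\<Sum>k<K. g (Suc k) A * f A ^ k)" for A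
    by (subst sum.lessThan_Suc_shift) (simp add: sum_distrib_left mult_ac)
  have "g 0 A = 0" if "A \<in> Z" for A
    using Suc.prems(3)[of A] that sub f(2) unfolding split by auto
  then have g0: "g 0 A = 0" for A using Suc.prems(2)[of 0] by blast
  have "(\<forall>A\<in>Z'. f A = 0) \<or> (\<forall>A\<in>Z'. (\<Sum>k<K. g (Suc k) A * f A ^ k) = 0)"
  proof (rule irreducible_in_zariski_domain[OF Z' f(1)])
    show "(\<lambda>A. \<Sum>k<K. g (Suc k) A * f A ^ k) \<in> poly_funs n"
      by (intro poly_funs_sum poly_funs.mult poly_funs_power f(1) Suc.prems(1)) auto
    show "f A * (\<Sum>k<K. g (Suc k) A * f A ^ k) = 0" if "A \<in> Z'" for A
      using Suc.prems(3)[OF that] unfolding split by (simp add: g0)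
  qed
  then have rel: "(\<Sum>k<K. g (Suc k) A * f A ^ k) = 0" if "A \<in> Z'" for A
    using f(3) that by blast
  have gS: "g (Suc k) A = 0" if k: "k < K" for k A
  proof (rule Suc.IH[of "\<lambda>k. g (Suc k)", OF _ _ rel k])
    show "g (Suc k) \<in> poly_funs n" if "k < K" for k using Suc.prems(1) that by blast
    show "\<forall>A. g (Suc k) A = 0" if "k < K" "\<forall>A\<in>Z. g (Suc k) A = 0" for k
      using Suc.prems(2)[of "Suc k"] that by blast
  qed
  show ?case
  proof (cases k)
    case 0
    then show ?thesis using g0 by blast
  next
    case (Suc k')
    then show ?thesis using gS[of k'] Suc.prems(4) by blast
  qed
qed

text \<open>A polynomial in \<open>m + 1\<close> functions is read as a polynomial in the last one,
  the form to which \<open>irreducible_power_relation\<close> applies.\<close>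

lemma sum_exponents_Suc:
  "(\<Sum>a\<in>exponents {..<Suc m} K. c a * monomial_fun {..<Suc m} f a x)
    = (\<Sum>k<K. (\<Sum>a\<in>exponents {..<m} K. c (a(m := k)) * monomial_fun {..<m} f a x) * f m x ^ k)"
proof -
  let ?h = "\<lambda>(k, a). a(m := k :: nat)"
  have mono: "monomial_fun {..<Suc m} f (a(m := k)) x = monomial_fun {..<m} f a x * f m x ^ k" for a k
    by (simp add: monomial_fun_def lessThan_Suc)
  have "(\<Sum>a\<in>exponents {..<Suc m} K. c a * monomial_fun {..<Suc m} f a x)
    = (\<Sum>a\<in>?h ` ({..<K} \<times> exponents {..<m} K). c a * monomial_fun {..<Suc m} f a x)"
    by (simp add: exponents_def lessThan_Suc PiE_insert_eq)
  also have "\<dots> = (\<Sum>p\<in>{..<K} \<times> exponents {..<m} K. c (?h p) * monomial_fun {..<Suc m} f (?h p) x)"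
    unfolding exponents_def by (subst sum.reindex) (auto intro!: inj_combinator)
  also have "\<dots> = (\<Sum>k<K. \<Sum>a\<in>exponents {..<m} K. c (a(m := k)) * monomial_fun {..<m} f a x * f m x ^ k)"
    by (simp add: sum.cartesian_product case_prod_beta mono mult.assoc)
  finally show ?thesis by (simp add: sum_distrib_right)
qed

text \<open>In a relation on \<open>Z (Suc m)\<close>, the coefficients of the powers of
  \<open>f m\<close> are polynomials in the earlier functions. These are independent on
  \<open>Z m\<close>, where \<open>f m\<close> vanishes, so such a coefficient is zero as soon as it
  vanishes on \<open>Z m\<close>.\<close>

lemma chain_alg_indep:
  assumes irr: "\<And>i. i \<le> m \<Longrightarrow> irreducible_in (zariski_sym n) (Z i)"
    and sub: "\<And>i. i < m \<Longrightarrow> Z i \<subseteq> Z (Suc i)"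
    and f: "\<And>i. i < m \<Longrightarrow> f i \<in> poly_funs n"
    and van: "\<And>i A. i < m \<Longrightarrow> A \<in> Z i \<Longrightarrow> f i A = 0"
    and nonvan: "\<And>i. i < m \<Longrightarrow> \<exists>A\<in>Z (Suc i). f i A \<noteq> 0"
  shows "alg_indep_on (Z m) {..<m} f"
  using assms
proof (induction m)
  case 0
  \<comment> \<open>Without functions the only monomial is 1, and independence means that the set is
    nonempty.\<close>
  then have "Z 0 \<noteq> {}" by (simp add: irreducible_in_def)
  then show ?case by (auto simp: alg_indep_on_def exponents_def monomial_fun_def)
next
  case (Suc m)
  have IH: "alg_indep_on (Z m) {..<m} f"
    by (rule Suc.IH) (use Suc.prems in auto)
  show ?case unfolding alg_indep_on_def
  proof (intro allI impI ballI)
    fix K c a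
    assume rel: "\<forall>A\<in>Z (Suc m). (\<Sum>a\<in>exponents {..<Suc m} K. c a * monomial_fun {..<Suc m} f a A) = 0"
      and a: "a \<in> exponents {..<Suc m} K"
    define g where "g k A = (\<Sum>a\<in>exponents {..<m} K. c (a(m := k)) * monomial_fun {..<m} f a A)" for k A
    have g_coeff: "\<forall>a\<in>exponents {..<m} K. c (a(m := k)) = 0" if "\<forall>A\<in>Z m. g k A = 0" for k
      using IH[unfolded alg_indep_on_def, THEN spec, of K, THEN spec, of "\<lambda>a. c (a(m := k))"] that
      unfolding g_def by blast
    have g0: "g k A = 0" if "k < K" for k A
    proof (rule irreducible_power_relation[where Z' = "Z (Suc m)" and Z = "Z m" and f = "f m" and K = K])
      show "g k \<in> poly_funs n" for k
        unfolding g_def[abs_def] by (intro poly_funs_sum poly_funs.mult poly_funs.const poly_funs_monomial_fun)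
          (use Suc.prems in auto)
      show "\<forall>A. g k A = 0" if "\<forall>A\<in>Z m. g k A = 0" for k
        using g_coeff[OF that] by (simp add: g_def)
      show "(\<Sum>k<K. g k A * f m A ^ k) = 0" if "A \<in> Z (Suc m)" for A
        using bspec[OF rel that] unfolding sum_exponents_Suc g_def .
    qed (use Suc.prems that in auto)
    have "a \<in> (\<lambda>(k, a). a(m := k)) ` ({..<K} \<times> exponents {..<m} K)"
      using a by (simp add: exponents_def lessThan_Suc PiE_insert_eq)
    then obtain k b where "k < K" "b \<in> exponents {..<m} K" "a = b(m := k)" by auto
    then show "c a = 0" using g_coeff[of k] g0 by blast
  qed
qed

section \<open>Krull dimension of a closed subspace\<close>

lemma irreducible_in_subtopology:
  assumes "closedin X S" "Z \<subseteq> S"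
  shows "irreducible_in (subtopology X S) Z \<longleftrightarrow> irreducible_in X Z"
proof
  assume L: "irreducible_in (subtopology X S) Z"
  show "irreducible_in X Z" unfolding irreducible_in_def
  proof (intro conjI allI impI)
    show "Z \<subseteq> topspace X" "Z \<noteq> {}" using L by (auto simp: irreducible_in_def)
    fix Y Y' assume "closedin X Y \<and> closedin X Y' \<and> Z \<subseteq> Y \<union> Y'"
    then have "closedin (subtopology X S) (Y \<inter> S) \<and> closedin (subtopology X S) (Y' \<inter> S) \<and> Z \<subseteq> (Y \<inter> S) \<union> (Y' \<inter> S)"
      using assms(2) by (auto simp: closedin_subtopology)
    then have "Z \<subseteq> Y \<inter> S \<or> Z \<subseteq> Y' \<inter> S"
      using L unfolding irreducible_in_def by blast
    then show "Z \<subseteq> Y \<or> Z \<subseteq> Y'" by blast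
  qed
next
  assume R: "irreducible_in X Z"
  have "closedin X Y" if "closedin (subtopology X S) Y" for Y
    using that closedin_closed_subtopology[OF assms(1)] by blast
  then show "irreducible_in (subtopology X S) Z"
    using R assms(2) unfolding irreducible_in_def by (auto simp: topspace_subtopology)
qed

text \<open>Closed irreducible subsets of the closed subspace are those of \<open>X\<close> that lie
  in \<open>S\<close>. Hence chains can be taken in \<open>X\<close>: \<open>upper\<close> bounds
  all of them, and \<open>chain\<close> exhibits one of length \<open>d\<close>.\<close>

lemma krull_dim_closed_subtopology:
  assumes S: "closedin X S"
    and upper: "\<And>m Z. (\<And>i. i \<le> m \<Longrightarrow> closedin X (Z i) \<and> irreducible_in X (Z i)) \<Longrightarrow>
      (\<And>i. i < m \<Longrightarrow> Z i \<subset> Z (Suc i)) \<Longrightarrow> Z m \<subseteq> S \<Longrightarrow> m \<le> d"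
    and chain: "\<And>i. i \<le> d \<Longrightarrow> closedin X (Z i) \<and> irreducible_in X (Z i) \<and> Z i \<subseteq> S"
      "\<And>i. i < d \<Longrightarrow> Z i \<subset> Z (Suc i)"
  shows "krull_dim (subtopology X S) = enat d"
  unfolding krull_dim_def
proof (rule antisym)
  show "Sup {enat d | d. \<exists>Z. (\<forall>i\<le>d. closedin (subtopology X S) (Z i) \<and> irreducible_in (subtopology X S) (Z i))
      \<and> (\<forall>i<d. Z i \<subset> Z (Suc i))} \<le> enat d"
  proof (rule Sup_least, clarify)
    fix m and Z :: "nat \<Rightarrow> 'a set"
    assume Z: "\<forall>i\<le>m. closedin (subtopology X S) (Z i) \<and> irreducible_in (subtopology X S) (Z i)"
      and str: "\<forall>i<m. Z i \<subset> Z (Suc i)"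
    have "closedin X (Z i) \<and> Z i \<subseteq> S" if "i \<le> m" for i
      using Z that closedin_closed_subtopology[OF S] by blast
    then show "enat m \<le> enat d"
      using upper[of m Z] Z str irreducible_in_subtopology[OF S] by auto
  qed
  show "enat d \<le> Sup {enat d | d. \<exists>Z. (\<forall>i\<le>d. closedin (subtopology X S) (Z i) \<and> irreducible_in (subtopology X S) (Z i))
      \<and> (\<forall>i<d. Z i \<subset> Z (Suc i))}"
    using chain irreducible_in_subtopology[OF S] closedin_closed_subtopology[OF S]
    by (intro Sup_upper CollectI exI[of _ d] conjI refl exI[of _ Z]) auto
qed

text \<open>Reading the family backwards, from an index beyond \<open>K\<close> down to 0, each
  index in \<open>K\<close> contributes one strict inclusion.\<close>

lemma chain_of_decreasing_family:
  assumes K: "finite K" and dec: "\<And>v. W (Suc v) \<subseteq> W v" and strict: "\<And>v. v \<in> K \<Longrightarrow> W (Suc v) \<noteq> (W v :: 'a set)"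
  shows "\<exists>Z :: nat \<Rightarrow> 'a set. (\<forall>i\<le>card K. Z i \<in> range W) \<and> (\<forall>i<card K. Z i \<subset> Z (Suc i))"
proof -
  obtain N where N: "K \<subseteq> {..<N}" using K by (metis finite_nat_iff_bounded)
  \<comment> \<open>Keeping the top of the partial chain inside \<open>W v\<close> is what allows
    the next larger set to be put on top.\<close>
  have "\<exists>Z. (\<forall>i\<le>card (K \<inter> {v..}). Z i \<in> range W) \<and>
      (\<forall>i<card (K \<inter> {v..}). Z i \<subset> Z (Suc i)) \<and> Z (card (K \<inter> {v..})) \<subseteq> W v" if "v \<le> N" for v
    using that
  proof (induction v rule: inc_induct)
    case base
    have "K \<inter> {N..} = {}" using N by auto
    then show ?case by (intro exI[of _ "\<lambda>_. W N"]) auto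
  next
    case (step v)
    then obtain Z where Z: "\<forall>i\<le>card (K \<inter> {Suc v..}). Z i \<in> range W"
      "\<forall>i<card (K \<inter> {Suc v..}). Z i \<subset> Z (Suc i)" "Z (card (K \<inter> {Suc v..})) \<subseteq> W (Suc v)"
      by blast
    show ?case
    proof (cases "v \<in> K")
      case True
      have "K \<inter> {v..} = insert v (K \<inter> {Suc v..})" using True by auto
      then have card: "card (K \<inter> {v..}) = Suc (card (K \<inter> {Suc v..}))" using K by simp
      have "Z (card (K \<inter> {Suc v..})) \<subset> W v" using Z(3) dec[of v] strict[OF True] by blast
      then show ?thesis unfolding card using Z
        by (intro exI[of _ "Z(Suc (card (K \<inter> {Suc v..})) := W v)"])
           (auto simp: less_Suc_eq le_Suc_eq)
    next
      case False
      have "K \<inter> {v..} = K \<inter> {Suc v..}" using False by (auto simp: Suc_le_eq le_less)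
      then show ?thesis using Z dec[of v] by (intro exI[of _ Z]) auto
    qed
  qed
  from this[of 0] show ?thesis by (auto simp: Int_absorb2)
qed

section \<open>Irreducible closures of parametrized sets\<close>

lemma poly_fun_along_curve:
  assumes "\<And>i j. i < n \<Longrightarrow> j < n \<Longrightarrow> \<exists>p. \<forall>t. \<gamma> t $$ (i, j) = poly p t" and "f \<in> poly_funs n"
  shows "\<exists>p. \<forall>t. f (\<gamma> t) = poly p t"
  using assms(2)
proof induction
  case (const c)
  show ?case by (intro exI[of _ "[:c:]"]) simp
next
  case (entry i j)
  then show ?case using assms(1) by blast
next
  case (add f g)
  then show ?case by (metis poly_add)
next
  case (mult f g)
  then show ?case by (metis poly_mult)
qed

text \<open>A product of polynomial functions vanishing on the image vanishes along every curve below; it is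
  there a product of univariate polynomials, up to the finitely many parameters excluded by \<open>r\<close>.\<close>

lemma irreducible_in_closure_image:
  fixes \<phi> :: "'b \<Rightarrow> complex mat"
  assumes ne: "U \<noteq> {}" and sym: "\<phi> ` U \<subseteq> sym_mats n"
    and curve: "\<And>B B'. B \<in> U \<Longrightarrow> B' \<in> U \<Longrightarrow> \<exists>\<gamma> r. r \<noteq> 0 \<and> (\<forall>t::complex. poly r t \<noteq> 0 \<longrightarrow> \<gamma> t \<in> U) \<and>
      \<gamma> 0 = B \<and> \<gamma> 1 = B' \<and> (\<forall>i<n. \<forall>j<n. \<exists>p. \<forall>t. \<phi> (\<gamma> t) $$ (i, j) = poly p t)"
  shows "irreducible_in (zariski_sym n) (zariski_sym n closure_of (\<phi> ` U))"
  unfolding irreducible_in_def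
proof (intro conjI allI impI)
  let ?X = "zariski_sym n"
  have sub: "\<phi> ` U \<subseteq> ?X closure_of (\<phi> ` U)"
    using sym by (simp add: closure_of_subset topspace_zariski_sym)
  show "?X closure_of (\<phi> ` U) \<subseteq> topspace ?X" by (rule closure_of_subset_topspace)
  show "?X closure_of (\<phi> ` U) \<noteq> {}" using sub ne by auto
  fix Y Z assume YZ: "closedin ?X Y \<and> closedin ?X Z \<and> ?X closure_of (\<phi> ` U) \<subseteq> Y \<union> Z"
  show "?X closure_of (\<phi> ` U) \<subseteq> Y \<or> ?X closure_of (\<phi> ` U) \<subseteq> Z"
  proof (rule ccontr)
    assume contra: "\<not> ?thesis"
    then have "\<not> \<phi> ` U \<subseteq> Y" "\<not> \<phi> ` U \<subseteq> Z" using YZ closure_of_minimal by metis+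
    then obtain B B' where B: "B \<in> U" "\<phi> B \<notin> Y" and B': "B' \<in> U" "\<phi> B' \<notin> Z" by blast
    obtain f where f: "f \<in> poly_funs n" "\<And>A. A \<in> Y \<Longrightarrow> f A = 0" "f (\<phi> B) \<noteq> 0"
      using closedin_separate[of n Y "\<phi> B"] YZ B sym by blast
    obtain g where g: "g \<in> poly_funs n" "\<And>A. A \<in> Z \<Longrightarrow> g A = 0" "g (\<phi> B') \<noteq> 0"
      using closedin_separate[of n Z "\<phi> B'"] YZ B' sym by blast
    obtain \<gamma> r where \<gamma>: "r \<noteq> 0" "\<And>t. poly r t \<noteq> 0 \<Longrightarrow> \<gamma> t \<in> U" "\<gamma> 0 = B" "\<gamma> 1 = B'"
      "\<And>i j. i < n \<Longrightarrow> j < n \<Longrightarrow> \<exists>p. \<forall>t. \<phi> (\<gamma> t) $$ (i, j) = poly p t"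
      using curve[OF B(1) B'(1)] by blast
    obtain p where p: "\<And>t. f (\<phi> (\<gamma> t)) = poly p t"
      using poly_fun_along_curve[of n "\<lambda>t. \<phi> (\<gamma> t)" f] \<gamma>(5) f(1) by blast
    obtain q where q: "\<And>t. g (\<phi> (\<gamma> t)) = poly q t"
      using poly_fun_along_curve[of n "\<lambda>t. \<phi> (\<gamma> t)" g] \<gamma>(5) g(1) by blast
    \<comment> \<open>The ends of the curve show that neither polynomial is zero: \<open>p\<close>
      is nonzero at 0 and \<open>q\<close> at 1.\<close>
    have "p \<noteq> 0" using p[of 0] f(3) \<gamma>(3) by auto
    moreover have "q \<noteq> 0" using q[of 1] g(3) \<gamma>(4) by auto
    ultimately have "p * q * r \<noteq> 0" using \<gamma>(1) by simp
    then have "finite {t. poly (p * q * r) t = 0}" by (rule poly_roots_finite)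
    then have "{t. poly (p * q * r) t = 0} \<noteq> UNIV" using infinite_UNIV_char_0 by metis
    then obtain t where t: "poly (p * q * r) t \<noteq> 0" by auto
    then have "\<phi> (\<gamma> t) \<in> Y \<union> Z" using \<gamma>(2)[of t] sub YZ by auto
    then show False using f(2) g(2) p[of t] q[of t] t by auto
  qed
qed

text \<open>The chain supplies \<open>m\<close> functions independent on its top. A relation between
  them on \<open>C\<close> persists on the closure, so they are independent on \<open>C\<close>
  already, where they are regular in \<open>card E\<close> coordinates.\<close>

lemma chain_length_le:
  assumes C: "C \<subseteq> sym_mats n" and coord: "coordinates E"
    and reg: "\<And>f. f \<in> poly_funs n \<Longrightarrow> f \<in> coordinates.regular C E u"
    and Z: "\<And>i. i \<le> m \<Longrightarrow> closedin (zariski_sym n) (Z i) \<and> irreducible_in (zariski_sym n) (Z i)"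
    and strict: "\<And>i. i < m \<Longrightarrow> Z i \<subset> Z (Suc i)"
    and top: "Z m \<subseteq> zariski_sym n closure_of C"
  shows "m \<le> card E"
proof -
  interpret coordinates C E u by (rule coord)
  have "\<exists>f. f \<in> poly_funs n \<and> (\<forall>A\<in>Z i. f A = 0) \<and> (\<exists>A\<in>Z (Suc i). f A \<noteq> 0)" if i: "i < m" for i
  proof -
    obtain A where A: "A \<in> Z (Suc i)" "A \<notin> Z i" using strict[OF i] by blast
    have "A \<in> sym_mats n" using Z[of "Suc i"] i A closedin_subset topspace_zariski_sym by fastforce
    from closedin_separate[OF _ this A(2)] Z[of i] i obtain f
      where "f \<in> poly_funs n" "\<And>B. B \<in> Z i \<Longrightarrow> f B = 0" "f A \<noteq> 0" by auto
    then show ?thesis using A(1) by (intro exI[of _ f]) auto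
  qed
  then obtain f where f: "\<And>i. i < m \<Longrightarrow> f i \<in> poly_funs n \<and> (\<forall>A\<in>Z i. f i A = 0) \<and> (\<exists>A\<in>Z (Suc i). f i A \<noteq> 0)"
    by metis
  have "alg_indep_on (Z m) {..<m} f"
    by (rule chain_alg_indep[of m n]) (use Z strict f in auto)
  moreover have "\<forall>A\<in>Z m. (\<Sum>a\<in>exponents {..<m} K. c a * monomial_fun {..<m} f a A) = 0"
    if "\<forall>A\<in>C. (\<Sum>a\<in>exponents {..<m} K. c a * monomial_fun {..<m} f a A) = 0" for K c
  proof
    fix A assume "A \<in> Z m"
    then have "A \<in> zariski_sym n closure_of C" using top by blast
    moreover have "(\<lambda>A. \<Sum>a\<in>exponents {..<m} K. c a * monomial_fun {..<m} f a A) \<in> poly_funs n"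
      by (intro poly_funs_sum poly_funs.mult poly_funs.const poly_funs_monomial_fun) (use f in auto)
    ultimately show "(\<Sum>a\<in>exponents {..<m} K. c a * monomial_fun {..<m} f a A) = 0"
      using vanishing_on_closure[OF C] that by blast
  qed
  ultimately have "alg_indep_on C {..<m} f"
    unfolding alg_indep_on_def by (intro allI impI) (elim allE impE, assumption)
  from alg_indep_card_le[OF _ _ this] show ?thesis using reg f by simp
qed

section \<open>Partial involutions and their orbits\<close>

text \<open>The determinant of a triangular matrix is the product of its diagonal, so invertibility
  becomes a condition on single entries.\<close>

lemma borel_group_iff:
  "B \<in> borel_group n \<longleftrightarrow>
    B \<in> carrier_mat n n \<and> (\<forall>i<n. \<forall>j<i. B $$ (i, j) = 0) \<and> (\<forall>i<n. B $$ (i, i) \<noteq> 0)"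
proof -
  have inv: "invertible_mat B \<longleftrightarrow> det B \<noteq> 0" if B: "B \<in> carrier_mat n n" for B :: "complex mat"
  proof
    assume "invertible_mat B"
    then obtain C where C: "B * C = 1\<^sub>m n" "C * B = 1\<^sub>m (dim_row C)"
      using B unfolding invertible_mat_def inverts_mat_def by auto
    have "dim_col (B * C) = n" "dim_col (C * B) = dim_row C" by (simp_all only: C index_one_mat)
    then have "C \<in> carrier_mat n n" using B by auto
    then have "det B * det C = 1" using det_mult[OF B] C(1) by (metis det_one)
    then show "det B \<noteq> 0" by auto
  next
    assume "det B \<noteq> 0"
    from det_non_zero_imp_unit[OF B this] obtain C where
      "C \<in> carrier_mat n n" "B * C = 1\<^sub>m n" "C * B = 1\<^sub>m n"
      unfolding Units_def ring_mat_def by auto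
    then show "invertible_mat B" using B unfolding invertible_mat_def inverts_mat_def by auto
  qed
  have tri: "upper_triangular B \<longleftrightarrow> (\<forall>i<n. \<forall>j<i. B $$ (i, j) = 0)" if "B \<in> carrier_mat n n"
    using that unfolding upper_triangular_def by auto
  have "det B \<noteq> 0 \<longleftrightarrow> (\<forall>i<n. B $$ (i, i) \<noteq> 0)" if "B \<in> carrier_mat n n" "upper_triangular B"
    using det_upper_triangular[OF that(2,1)] that(1)
    by (auto simp: diag_mat_def prod_list_zero_iff)
  then show ?thesis unfolding borel_group_def using inv tri by auto
qed

text \<open>Up to the order of the indices the submatrix is triangular. Instead of sorting them, the
  proof takes a kernel vector and its nonzero coordinate \<open>r\<close> with the largest
  \<open>f r\<close>: there row \<open>r\<close> reduces to its diagonal term.\<close>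

lemma det_upper_triangular_submatrix_nonzero:
  fixes B :: "complex mat"
  assumes B: "B \<in> borel_group n" and f: "inj_on f {..<k}" "\<And>r. r < k \<Longrightarrow> f r < n"
  shows "det (mat k k (\<lambda>(p, q). B $$ (f p, f q))) \<noteq> 0"
proof
  let ?M = "mat k k (\<lambda>(p, q). B $$ (f p, f q))"
  assume "det ?M = 0"
  then obtain v where v: "v \<in> carrier_vec k" "v \<noteq> 0\<^sub>v k" "?M *\<^sub>v v = 0\<^sub>v k"
    using det_0_iff_vec_prod_zero[of ?M k] by auto
  let ?S = "{r. r < k \<and> v $ r \<noteq> 0}"
  have "?S \<noteq> {}" using v(1,2) by (auto intro!: eq_vecI)
  then have fin: "finite (f ` ?S)" "f ` ?S \<noteq> {}" by auto
  obtain r where r: "r < k" "v $ r \<noteq> 0" "f r = Max (f ` ?S)"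
    using Max_in[OF fin] by auto
  have max: "f q \<le> f r" if "q < k" "v $ q \<noteq> 0" for q
    using that fin by (auto simp: r(3) intro!: Max_ge)
  have "0 = (?M *\<^sub>v v) $ r" using v(3) r(1) by simp
  also have "\<dots> = (\<Sum>q<k. B $$ (f r, f q) * v $ q)"
    using r(1) v(1) by (simp add: scalar_prod_def lessThan_atLeast0)
  also have "\<dots> = (\<Sum>q<k. if q = r then B $$ (f r, f r) * v $ r else 0)"
  proof (rule sum.cong)
    fix q assume q: "q \<in> {..<k}"
    show "B $$ (f r, f q) * v $ q = (if q = r then B $$ (f r, f r) * v $ r else 0)"
    proof (cases "q = r \<or> v $ q = 0")
      case False
      then have "f q < f r" using max[of q] f(1) q r(1) by (auto simp: inj_on_def le_less)
      then show ?thesis using B f(2)[OF r(1)] False by (auto simp: borel_group_iff)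
    qed auto
  qed simp
  also have "\<dots> = B $$ (f r, f r) * v $ r" using r(1) by simp
  finally show False using r B f(2)[OF r(1)] by (auto simp: borel_group_iff)
qed

lemma sym_mats_index:
  assumes "A \<in> sym_mats n" "i < n" "j < n"
  shows "A $$ (i, j) = A $$ (j, i)"
proof -
  have A: "A \<in> carrier_mat n n" "transpose_mat A = A" using assms(1) by (auto simp: sym_mats_def)
  have "transpose_mat A $$ (j, i) = A $$ (i, j)" using A(1) assms(2,3) by simp
  then show ?thesis unfolding A(2) by simp
qed

lemma card_triangle: "2 * card {(i, j). i \<le> j \<and> j < m} = m ^ 2 + (m::nat)"
proof (induction m)
  case (Suc m)
  have "{(i, j). i \<le> j \<and> j < Suc m} = {(i, j). i \<le> j \<and> j < m} \<union> (\<lambda>i. (i, m)) ` {..m}"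
    by (auto simp: less_Suc_eq)
  moreover have "finite {(i, j). i \<le> j \<and> j < m}"
    by (rule finite_subset[of _ "{..<m} \<times> {..<m}"]) auto
  moreover have "card ((\<lambda>i. (i, m)) ` {..m}) = Suc m"
    by (subst card_image) (auto simp: inj_on_def)
  moreover have "{(i, j). i \<le> j \<and> j < m} \<inter> (\<lambda>i. (i, m)) ` {..m} = {}" by auto
  ultimately have "card {(i, j). i \<le> j \<and> j < Suc m} = card {(i, j). i \<le> j \<and> j < m} + Suc m"
    by (simp add: card_Un_disjoint)
  then show ?case using Suc by (simp add: power2_eq_square)
qed simp

locale partial_inv =
  fixes n :: nat and \<pi> :: "complex mat"
  assumes partial_involution: "partial_involution n \<pi>"
begin

definition ones :: "(nat \<times> nat) set" where
  "ones = {(a, b). a < n \<and> b < n \<and> \<pi> $$ (a, b) = 1}"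

lemma ones_less: "(a, b) \<in> ones \<Longrightarrow> a < n \<and> b < n"
  by (simp add: ones_def)

lemma finite_ones: "finite ones"
  by (rule finite_subset[of _ "{..<n} \<times> {..<n}"]) (auto simp: ones_def)

lemma pi_carrier: "\<pi> \<in> carrier_mat n n"
  using partial_involution by (simp add: partial_involution_def sym_mats_def)

lemma pi_index: "i < n \<Longrightarrow> j < n \<Longrightarrow> \<pi> $$ (i, j) = (if (i, j) \<in> ones then 1 else 0)"
  using partial_involution by (auto simp: partial_involution_def ones_def)

lemma ones_sym: "(a, b) \<in> ones \<Longrightarrow> (b, a) \<in> ones"
proof -
  assume ab: "(a, b) \<in> ones"
  have "transpose_mat \<pi> = \<pi>" using partial_involution by (simp add: partial_involution_def sym_mats_def)
  then have "\<pi> $$ (b, a) = \<pi> $$ (a, b)"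
    using ab pi_carrier by (metis carrier_matD index_transpose_mat(1) ones_less)
  then show ?thesis using ab by (simp add: ones_def)
qed

lemma ones_fun:
  assumes "(a, b) \<in> ones" "(a, c) \<in> ones"
  shows "b = c"
proof -
  have "\<forall>i<n. card {j. j < n \<and> \<pi> $$ (i, j) = 1} \<le> 1"
    using partial_involution by (simp add: partial_involution_def)
  then have "card {j. j < n \<and> \<pi> $$ (a, j) = 1} \<le> Suc 0" using ones_less[OF assms(1)] by simp
  moreover have "finite {j. j < n \<and> \<pi> $$ (a, j) = 1}" by simp
  ultimately have "\<forall>x\<in>{j. j < n \<and> \<pi> $$ (a, j) = 1}. \<forall>y\<in>{j. j < n \<and> \<pi> $$ (a, j) = 1}. x = y"
    using card_le_Suc0_iff_eq by blast
  then show ?thesis using assms by (simp add: ones_def)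
qed

lemma ones_inj: "(a, c) \<in> ones \<Longrightarrow> (b, c) \<in> ones \<Longrightarrow> a = b"
  using ones_fun ones_sym by blast

text \<open>Only the ones of \<open>\<pi>\<close> survive in the double product. Later computations
  of orbit entries start from this sum.\<close>

lemma congruence_index:
  assumes B: "B \<in> carrier_mat n n" and ij: "i < n" "j < n"
  shows "(transpose_mat B * \<pi> * B) $$ (i, j) = (\<Sum>(a, b)\<in>ones. B $$ (a, i) * B $$ (b, j))"
proof -
  have "(transpose_mat B * \<pi> * B) $$ (i, j) = (\<Sum>a<n. \<Sum>b<n. B $$ (a, i) * \<pi> $$ (a, b) * B $$ (b, j))"
    using B pi_carrier ij
    by (simp add: scalar_prod_def lessThan_atLeast0 sum_distrib_left mult_ac)
  also have "\<dots> = (\<Sum>(a, b)\<in>{..<n} \<times> {..<n}. B $$ (a, i) * \<pi> $$ (a, b) * B $$ (b, j))"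
    by (simp add: sum.cartesian_product)
  also have "\<dots> = (\<Sum>(a, b)\<in>ones. B $$ (a, i) * B $$ (b, j))"
    by (rule sum.mono_neutral_cong_right) (auto simp: pi_index ones_less dest: ones_less)
  finally show ?thesis .
qed

lemma congruence_in_sym_mats:
  assumes "B \<in> carrier_mat n n"
  shows "transpose_mat B * \<pi> * B \<in> sym_mats n"
proof -
  have swap: "(\<Sum>(a, b)\<in>ones. B $$ (a, j) * B $$ (b, i)) = (\<Sum>(a, b)\<in>ones. B $$ (a, i) * B $$ (b, j))" for i j
    by (rule sum.reindex_bij_witness[of _ prod.swap prod.swap]) (auto intro: ones_sym)
  have "transpose_mat (transpose_mat B * \<pi> * B) $$ (i, j) = (transpose_mat B * \<pi> * B) $$ (i, j)"
    if "i < n" "j < n" for i j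
  proof -
    have "transpose_mat (transpose_mat B * \<pi> * B) $$ (i, j) = (transpose_mat B * \<pi> * B) $$ (j, i)"
      by (rule index_transpose_mat) (use assms pi_carrier that in auto)
    then show ?thesis
      unfolding congruence_index[OF assms that] congruence_index[OF assms that(2,1)] using swap by simp
  qed
  moreover have "transpose_mat B * \<pi> * B \<in> carrier_mat n n" using assms pi_carrier by simp
  ultimately show ?thesis unfolding sym_mats_def
    by (intro CollectI conjI eq_matI) auto
qed

lemma orbit_subset: "congruence_orbit n \<pi> \<subseteq> sym_mats n"
  using congruence_in_sym_mats by (auto simp: congruence_orbit_def borel_group_def)

text \<open>Indices are counted from \<open>0\<close> here: the pair \<open>(i, j)\<close> corresponds to the entry \<open>(i + 1, j + 1)\<close>
  of the rank-control matrix.\<close>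

definition essential :: "nat \<Rightarrow> nat \<Rightarrow> bool" where
  "essential i j \<longleftrightarrow> (\<exists>b\<le>j. (i, b) \<in> ones) \<or> (\<exists>a\<le>i. (a, j) \<in> ones)"

definition E :: "(nat \<times> nat) set" where
  "E = {(i, j). i \<le> j \<and> j < n \<and> essential i j}"

lemma finite_E: "finite E"
  by (rule finite_subset[of _ "{..<n} \<times> {..<n}"]) (auto simp: E_def)

text \<open>The nonzero columns of the block are distinct unit vectors, one for each one in it, and
  form a maximal independent set of columns.\<close>

lemma rank_control_eq_card:
  assumes "i \<le> n" "j \<le> n"
  shows "rank_control \<pi> i j = card (ones \<inter> {..<i} \<times> {..<j})"
proof (cases "i = 0")
  case True
  then show ?thesis by (simp add: rank_control_def)
next
  case False
  interpret vec_space "TYPE(complex)" i .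
  let ?A = "mat i j (\<lambda>(k, l). \<pi> $$ (k, l))"
  let ?O = "ones \<inter> {..<i} \<times> {..<j}"
  let ?U = "(\<lambda>(a, b). unit_vec i a :: complex vec) ` ?O"
  have A: "?A \<in> carrier_mat i j" by simp
  have col1: "col ?A b = unit_vec i a" if "(a, b) \<in> ?O" for a b
  proof (rule eq_vecI)
    fix k assume "k < dim_vec (unit_vec i a)"
    then have k: "k < i" by simp
    have "(k, b) \<in> ones \<longleftrightarrow> k = a" using that ones_inj[of k b a] by auto
    then show "col ?A b $ k = unit_vec i a $ k"
      using that k assms by (simp add: pi_index)
  qed simp
  have col0: "col ?A b = 0\<^sub>v i" if "b < j" "\<And>a. (a, b) \<notin> ?O" for b
    using that assms by (intro eq_vecI) (auto simp: pi_index)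
  have cols: "set (cols ?A) = col ?A ` {..<j}" by (auto simp: cols_def)
  have U_sub: "?U \<subseteq> set (cols ?A)" 
  proof
    fix c assume "c \<in> ?U"
    then obtain a b where ab: "(a, b) \<in> ?O" "c = unit_vec i a" by auto
    then show "c \<in> set (cols ?A)" unfolding cols using col1[OF ab(1)] by (intro image_eqI[of _ _ b]) auto
  qed
  have sub_U: "set (cols ?A) \<subseteq> insert (0\<^sub>v i) ?U"
  proof
    fix c assume "c \<in> set (cols ?A)"
    then obtain b where b: "b < j" "c = col ?A b" unfolding cols by auto
    show "c \<in> insert (0\<^sub>v i) ?U"
    proof (cases "\<exists>a. (a, b) \<in> ?O")
      case True
      then obtain a where ab: "(a, b) \<in> ?O" by blast
      then have "unit_vec i a \<in> ?U" by (intro image_eqI[of _ _ "(a, b)"]) auto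
      then show ?thesis using col1[OF ab] b by simp
    qed (use col0 b in auto)
  qed
  have "lin_indpt (set (unit_vecs i))" using unit_vecs_basis by (simp add: basis_def)
  moreover have "?U \<subseteq> set (unit_vecs i)" by (auto simp: unit_vecs_def)
  ultimately have li: "lin_indpt ?U" by (rule subset_li_is_li)
  \<comment> \<open>Any further column is zero, and an independent set does not contain the zero
    vector.\<close>
  have "maximal ?U (\<lambda>T. T \<subseteq> set (cols ?A) \<and> lin_indpt T)"
    unfolding maximal_def
  proof (intro conjI allI impI U_sub li, elim conjE)
    fix T assume T: "?U \<subseteq> T" "T \<subseteq> set (cols ?A)" "lin_indpt T"
    have "T \<subseteq> carrier_vec i" using T(2) cols_dim[of ?A] by auto
    moreover have "(UNIV :: complex set) \<noteq> {0}" using one_neq_zero by blast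
    ultimately have "0\<^sub>v i \<notin> T" using zero_nin_lin_indpt[OF _ T(3)] by (simp add: module_vec_simps class_ring_simps)
    then show "T = ?U" using T(1,2) sub_U by blast
  qed
  then have "rank ?A = card ?U" by (rule rank_card_indpt[OF A])
  also have "\<dots> = card ?O"
  proof (rule card_image, rule inj_onI, clarify)
    fix a b a' b' assume O: "(a, b) \<in> ones" "(a', b') \<in> ones" "a < i" "a' < i"
      and eq: "unit_vec i a = (unit_vec i a' :: complex vec)"
    have "unit_vec i a $ a = (unit_vec i a' $ a :: complex)" using eq by simp
    then have "a = a'" using O by (simp split: if_splits)
    then show "a = a' \<and> b = b'" using O ones_fun by blast
  qed
  finally show ?thesis using False by (simp add: rank_control_def)
qed

text \<open>The larger block gains a last row \<open>i\<close> and a last column \<open>j\<close>;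
  the number of ones stays the same exactly if neither contains a one within the block.\<close>

lemma rank_control_Suc_eq_iff:
  assumes "i < n" "j < n"
  shows "rank_control \<pi> (Suc i) (Suc j) = rank_control \<pi> i j \<longleftrightarrow> \<not> essential i j"
proof -
  define S where "S = ones \<inter> {..<i} \<times> {..<j}"
  define T where "T = ones \<inter> {..<Suc i} \<times> {..<Suc j}"
  have S: "(a, b) \<in> S \<longleftrightarrow> (a, b) \<in> ones \<and> a < i \<and> b < j" for a b by (auto simp: S_def)
  have T: "(a, b) \<in> T \<longleftrightarrow> (a, b) \<in> ones \<and> a \<le> i \<and> b \<le> j" for a b by (auto simp: T_def)
  have sub: "S \<subseteq> T" by (auto simp: S_def T_def)
  have fin: "finite T" using finite_ones by (simp add: T_def)
  have "card T = card S \<longleftrightarrow> T \<subseteq> S"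
    using card_subset_eq[OF fin sub] sub by (metis equalityI order_refl)
  also have "\<dots> \<longleftrightarrow> \<not> essential i j"
  proof
    assume "T \<subseteq> S"
    then have "a < i \<and> b < j" if "(a, b) \<in> ones" "a \<le> i" "b \<le> j" for a b
      using S[of a b] T[of a b] that by blast
    then show "\<not> essential i j" unfolding essential_def by (meson less_irrefl order_refl)
  next
    assume ne: "\<not> essential i j"
    show "T \<subseteq> S"
    proof
      fix p assume "p \<in> T"
      moreover obtain a b where p: "p = (a, b)" by (cases p)
      ultimately have ab: "(a, b) \<in> ones" "a \<le> i" "b \<le> j" using T by blast+
      then have "a \<noteq> i" "b \<noteq> j" using ne unfolding essential_def by blast+
      then show "p \<in> S" using ab S p by simp
    qed
  qed
  finally show ?thesis
    using rank_control_eq_card[of "Suc i" "Suc j"] rank_control_eq_card[of i j] assms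
    unfolding S_def T_def by simp
qed

text \<open>The triangle of positions on and above the diagonal splits into the essential positions
  and, after a shift of indices by one, the diagonal repeats.\<close>

lemma card_E: "real (card E) = (real n ^ 2 + real n) / 2 - real (diag_repeats n \<pi>)"
proof -
  let ?T = "{(i, j). i \<le> j \<and> j < n}"
  have fin: "finite ?T" by (rule finite_subset[of _ "{..<n} \<times> {..<n}"]) auto
  have "{(i, j). 1 \<le> i \<and> i \<le> j \<and> j \<le> n \<and> rank_control \<pi> i j = rank_control \<pi> (i - 1) (j - 1)}
      = (\<lambda>(i, j). (Suc i, Suc j)) ` (?T - E)"
  proof (intro equalityI subsetI)
    fix p assume "p \<in> {(i, j). 1 \<le> i \<and> i \<le> j \<and> j \<le> n \<and> rank_control \<pi> i j = rank_control \<pi> (i - 1) (j - 1)}"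
    then obtain i' j' where p: "p = (i', j')" "1 \<le> i'" "i' \<le> j'" "j' \<le> n"
      "rank_control \<pi> i' j' = rank_control \<pi> (i' - 1) (j' - 1)" by blast
    define i j where "i = i' - 1" and "j = j' - 1"
    have ij: "p = (Suc i, Suc j)" "i \<le> j" "j < n"
      "rank_control \<pi> (Suc i) (Suc j) = rank_control \<pi> i j"
      using p unfolding i_def j_def by auto
    then have "(i, j) \<in> ?T - E" using rank_control_Suc_eq_iff[of i j] by (auto simp: E_def)
    then show "p \<in> (\<lambda>(i, j). (Suc i, Suc j)) ` (?T - E)" using ij(1) by force
  qed (use rank_control_Suc_eq_iff in \<open>auto simp: E_def\<close>)
  then have "diag_repeats n \<pi> = card (?T - E)"
    unfolding diag_repeats_def by (simp add: card_image inj_on_def split_beta prod_eq_iff)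
  moreover have "E \<subseteq> ?T" by (auto simp: E_def)
  ultimately have "diag_repeats n \<pi> + card E = card ?T"
    using card_Diff_subset[OF finite_E, of ?T] card_mono[OF fin, of E] by simp
  moreover have "real (2 * card ?T) = real (n ^ 2 + n)" by (simp only: card_triangle)
  ultimately show ?thesis by (simp add: field_simps)
qed

section \<open>Upper bound: coordinates on the orbit\<close>

sublocale orbit: coordinates "congruence_orbit n \<pi>" E "\<lambda>e S. S $$ e"
  by unfold_locales (rule finite_E)

text \<open>If \<open>(i, j)\<close> is not essential, then the ones of \<open>\<pi>\<close> in the upper left block ending at \<open>(i, j)\<close>
  lie at positions \<open>(e r, g r)\<close> strictly above and to the left. On the orbit the minor with rows \<open>e\<close> and
  columns \<open>g\<close> never vanishes, while the minor bordered by row \<open>i\<close> and column \<open>j\<close> always does; expanding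
  the latter along its last column solves for the entry \<open>(i, j)\<close>.\<close>

lemma regular_inessential_entry:
  assumes ij: "i \<le> j" "j < n" and iness: "\<not> essential i j"
    and earlier: "\<And>a b. a < n \<Longrightarrow> b < n \<Longrightarrow> a + b < i + j \<Longrightarrow> (\<lambda>S. S $$ (a, b)) \<in> orbit.regular"
  shows "(\<lambda>S. S $$ (i, j)) \<in> orbit.regular"
proof -
  define I where "I = {a. a < i \<and> (\<exists>b<j. (a, b) \<in> ones)}"
  define k where "k = card I"
  have "finite I" by (auto simp: I_def)
  then obtain e where e: "bij_betw e {..<k} I"
    using ex_bij_betw_nat_finite[of I] unfolding k_def lessThan_atLeast0 by blast
  have eI: "e r \<in> I" if "r < k" for r using bij_betwE[OF e] that by blast
  then have "\<forall>r. \<exists>b. r < k \<longrightarrow> b < j \<and> (e r, b) \<in> ones" unfolding I_def by blast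
  then obtain g where g: "\<And>r. r < k \<Longrightarrow> g r < j" "\<And>r. r < k \<Longrightarrow> (e r, g r) \<in> ones" by metis
  have e_less: "e r < i" if "r < k" for r using eI[OF that] by (simp add: I_def)
  have e_inj: "inj_on e {..<k}" using e by (rule bij_betw_imp_inj_on)
  have g_inj: "inj_on g {..<k}"
  proof (rule inj_onI)
    fix r s assume rs: "r \<in> {..<k}" "s \<in> {..<k}" "g r = g s"
    have "(e r, g r) \<in> ones" "(e s, g r) \<in> ones" using g(2)[of r] g(2)[of s] rs by simp_all
    then have "e r = e s" by (rule ones_inj)
    from inj_onD[OF e_inj this rs(1,2)] show "r = s" .
  qed
  \<comment> \<open>\<open>e'\<close> and \<open>g'\<close> attach the bordering row
    \<open>i\<close> and column \<open>j\<close> at the last index \<open>k\<close>.\<close>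
  define e' where "e' p = (if p < k then e p else i)" for p
  define g' where "g' q = (if q < k then g q else j)" for q
  have e'_le: "e' p \<le> i" for p using e_less[of p] by (auto simp: e'_def)
  have g'_le: "g' q \<le> j" for q using g(1)[of q] by (auto simp: g'_def)

  \<comment> \<open>Only the \<open>k\<close> chosen ones contribute. As \<open>(i, j)\<close> is
    inessential, any other one lies below row \<open>i\<close> or to the right of column
    \<open>j\<close>, where the triangular shape of \<open>B\<close> makes a factor vanish.\<close>
  have factor: "(transpose_mat B * \<pi> * B) $$ (e' p, g' q) = (\<Sum>r<k. B $$ (e r, e' p) * B $$ (g r, g' q))"
    if B: "B \<in> borel_group n" for B p q
  proof -
    have Bc: "B \<in> carrier_mat n n" and low: "\<And>a c. a < n \<Longrightarrow> c < a \<Longrightarrow> B $$ (a, c) = 0"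
      using B by (auto simp: borel_group_iff)
    have "(transpose_mat B * \<pi> * B) $$ (e' p, g' q) = (\<Sum>(a, b)\<in>ones. B $$ (a, e' p) * B $$ (b, g' q))"
      using e'_le[of p] g'_le[of q] ij by (intro congruence_index[OF Bc]) auto
    also have "\<dots> = (\<Sum>(a, b)\<in>(\<lambda>r. (e r, g r)) ` {..<k}. B $$ (a, e' p) * B $$ (b, g' q))"
    proof (rule sum.mono_neutral_right[OF finite_ones])
      show "(\<lambda>r. (e r, g r)) ` {..<k} \<subseteq> ones" using g(2) by auto
      show "\<forall>x\<in>ones - (\<lambda>r. (e r, g r)) ` {..<k}. (case x of (a, b) \<Rightarrow> B $$ (a, e' p) * B $$ (b, g' q)) = 0"
      proof
        fix x assume x: "x \<in> ones - (\<lambda>r. (e r, g r)) ` {..<k}"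
        obtain a b where ab: "x = (a, b)" by (cases x)
        have one: "(a, b) \<in> ones" using x ab by simp
        have "\<not> (a \<le> i \<and> b \<le> j)"
        proof
          assume le: "a \<le> i \<and> b \<le> j"
          then have "a \<noteq> i" "b \<noteq> j" using iness one unfolding essential_def by blast+
          then have "a < i" "b < j" using le by auto
          then have "a \<in> I" using one unfolding I_def by blast
          then obtain r where r: "r < k" "a = e r" using bij_betw_imp_surj_on[OF e] by blast
          then have "b = g r" using ones_fun[OF one] g(2)[of r] by simp
          then show False using x ab r by blast
        qed
        then have "e' p < a \<or> g' q < b" using e'_le[of p] g'_le[of q] by linarith
        then show "(case x of (a, b) \<Rightarrow> B $$ (a, e' p) * B $$ (b, g' q)) = 0"
          using low[of a "e' p"] low[of b "g' q"] ones_less[OF one] ab by auto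
      qed
    qed
    also have "\<dots> = (\<Sum>r<k. B $$ (e r, e' p) * B $$ (g r, g' q))"
    proof (subst sum.reindex)
      show "inj_on (\<lambda>r. (e r, g r)) {..<k}" using e_inj by (simp add: inj_on_def)
    qed simp
    finally show ?thesis .
  qed

  define M where "M S = mat (Suc k) (Suc k) (\<lambda>(p, q). S $$ (e' p, g' q))" for S :: "complex mat"
  define D where "D S = det (mat k k (\<lambda>(p, q). S $$ (e p, g q)))" for S :: "complex mat"
  \<comment> \<open>These are the cofactors of the last column, written out so that their regularity
    can be read off.\<close>
  define cof where "cof p S = (-1) ^ (p + k) * det (mat k k (\<lambda>(p', q').
      S $$ (e' (if p' < p then p' else Suc p'), g q')))" for p and S :: "complex mat"
  have M: "M S \<in> carrier_mat (Suc k) (Suc k)" for S by (simp add: M_def)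

  have detM: "det (M S) = 0" if S: "S \<in> congruence_orbit n \<pi>" for S
  proof -
    obtain B where B: "B \<in> borel_group n" "S = transpose_mat B * \<pi> * B"
      using S unfolding congruence_orbit_def by blast
    \<comment> \<open>A zero column in \<open>L\<close> and a zero row in \<open>R\<close> turn the
      sums over \<open>k\<close> ones into a product of square matrices with a singular
      factor.\<close>
    define L where "L = mat (Suc k) (Suc k) (\<lambda>(p, r). if r < k then B $$ (e r, e' p) else 0)"
    define R where "R = mat (Suc k) (Suc k) (\<lambda>(r, q). if r < k then B $$ (g r, g' q) else 0)"
    have L: "L \<in> carrier_mat (Suc k) (Suc k)" and R: "R \<in> carrier_mat (Suc k) (Suc k)"
      by (simp_all add: L_def R_def)
    have "M S = L * R"
    proof (rule eq_matI)
      fix p q assume "p < dim_row (L * R)" "q < dim_col (L * R)"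
      then have pq: "p < Suc k" "q < Suc k" by (simp_all add: L_def R_def)
      have "(L * R) $$ (p, q) = (\<Sum>r<Suc k. L $$ (p, r) * R $$ (r, q))"
        using L R pq by (simp add: scalar_prod_def lessThan_atLeast0)
      also have "\<dots> = (\<Sum>r<k. B $$ (e r, e' p) * B $$ (g r, g' q))"
        using pq by (simp add: L_def R_def)
      finally show "M S $$ (p, q) = (L * R) $$ (p, q)"
        using pq factor[OF B(1)] by (simp add: M_def B(2))
    qed (simp_all add: M_def L_def R_def)
    moreover have "det L = 0"
      using laplace_expansion_column[OF L, of k] by (simp add: L_def)
    ultimately show ?thesis by (simp add: det_mult[OF L R])
  qed

  have D0: "D S \<noteq> 0" if S: "S \<in> congruence_orbit n \<pi>" for S
  proof -
    obtain B where B: "B \<in> borel_group n" "S = transpose_mat B * \<pi> * B"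
      using S unfolding congruence_orbit_def by blast
    \<comment> \<open>The minor is a product of two minors of \<open>B\<close>, each with the same
      row and column indices, and these are nonzero by triangularity.\<close>
    let ?L = "mat k k (\<lambda>(p, q). B $$ (e p, e q))" and ?R = "mat k k (\<lambda>(p, q). B $$ (g p, g q))"
    have "mat k k (\<lambda>(p, q). S $$ (e p, g q)) = transpose_mat ?L * ?R"
    proof (rule eq_matI)
      fix p q assume "p < dim_row (transpose_mat ?L * ?R)" "q < dim_col (transpose_mat ?L * ?R)"
      then have pq: "p < k" "q < k" by simp_all
      have "(transpose_mat ?L * ?R) $$ (p, q) = (\<Sum>r<k. B $$ (e r, e p) * B $$ (g r, g q))"
        using pq by (simp add: scalar_prod_def lessThan_atLeast0)
      also have "\<dots> = S $$ (e p, g q)"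
        using factor[OF B(1), of p q] pq by (simp add: B(2) e'_def g'_def)
      finally show "mat k k (\<lambda>(p, q). S $$ (e p, g q)) $$ (p, q) = (transpose_mat ?L * ?R) $$ (p, q)"
        using pq by simp
    qed simp_all
    then have "D S = det ?L * det ?R"
      unfolding D_def using det_mult[of "transpose_mat ?L" k ?R] det_transpose[of ?L k] by simp
    moreover have "det ?L \<noteq> 0"
    proof (rule det_upper_triangular_submatrix_nonzero[OF B(1) e_inj])
      show "e r < n" if "r < k" for r using e_less[OF that] ij by linarith
    qed
    moreover have "det ?R \<noteq> 0"
    proof (rule det_upper_triangular_submatrix_nonzero[OF B(1) g_inj])
      show "g r < n" if "r < k" for r using g(1)[OF that] ij by linarith
    qed
    ultimately show ?thesis by simp
  qed

  have cofactor: "cofactor (M S) p k = cof p S" if "p < Suc k" for p S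
  proof -
    have "mat_delete (M S) p k = mat k k (\<lambda>(p', q'). S $$ (e' (if p' < p then p' else Suc p'), g q'))"
      unfolding mat_delete_def by (rule eq_matI) (auto simp: M_def g'_def)
    then show ?thesis by (simp add: cofactor_def cof_def)
  qed
  have cof_k: "cof k S = D S" for S
  proof -
    have "mat k k (\<lambda>(p', q'). S $$ (e' (if p' < k then p' else Suc p'), g q')) = mat k k (\<lambda>(p, q). S $$ (e p, g q))"
      by (rule eq_matI) (auto simp: e'_def)
    then show ?thesis by (simp add: cof_def D_def)
  qed
  have solve: "- (\<Sum>p<k. S $$ (e p, j) * cof p S) / D S = S $$ (i, j)"
    if S: "S \<in> congruence_orbit n \<pi>" for S
  proof -
    have "0 = (\<Sum>p<Suc k. M S $$ (p, k) * cofactor (M S) p k)"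
      using detM[OF S] laplace_expansion_column[OF M, of k] by simp
    also have "\<dots> = (\<Sum>p<k. S $$ (e p, j) * cof p S) + S $$ (i, j) * D S"
      using cofactor by (simp add: cof_k) (simp add: M_def e'_def g'_def)
    finally have "- (\<Sum>p<k. S $$ (e p, j) * cof p S) = S $$ (i, j) * D S"
      by (intro minus_unique) simp
    then show ?thesis using D0[OF S] by simp
  qed

  \<comment> \<open>Every other position in the block has a smaller index sum, so
    \<open>earlier\<close> covers it.\<close>
  have entry: "(\<lambda>S. S $$ (a, b)) \<in> orbit.regular" if "a \<le> i" "b \<le> j" "a \<noteq> i \<or> b \<noteq> j" for a b
    using that ij by (intro earlier) auto
  have entry_g: "(\<lambda>S. S $$ (a, g q)) \<in> orbit.regular" if "a \<le> i" "q < k" for a q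
    using g(1)[OF that(2)] that(1) by (intro entry) auto
  have "D \<in> orbit.regular"
    unfolding D_def[abs_def] by (intro orbit.regular_det entry_g less_imp_le[OF e_less])
  moreover have "cof p \<in> orbit.regular" for p
    unfolding cof_def[abs_def]
    by (intro orbit.regular_mult orbit.regular_const orbit.regular_det entry_g e'_le)
  moreover have "(\<lambda>S. S $$ (e p, j)) \<in> orbit.regular" if "p < k" for p
    using e_less[OF that] by (intro entry) auto
  ultimately have "(\<lambda>S. (- 1) * (\<Sum>p<k. S $$ (e p, j) * cof p S) / D S) \<in> orbit.regular"
    using D0 by (intro orbit.regular_divide orbit.regular_mult orbit.regular_const orbit.regular_sum) auto
  then show ?thesis
  proof (rule orbit.regular_cong)
    fix S assume "S \<in> congruence_orbit n \<pi>"
    from solve[OF this]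
    show "(- 1) * (\<Sum>p<k. S $$ (e p, j) * cof p S) / D S = S $$ (i, j)" by simp
  qed
qed

text \<open>Induction on \<open>i + j\<close>. The bordered minors may use entries below the
  diagonal, so these are included and reduced by symmetry to entries above it with the same index
  sum.\<close>

lemma regular_entry:
  assumes "i < n" "j < n"
  shows "(\<lambda>S. S $$ (i, j)) \<in> orbit.regular"
  using assms
proof (induction "i + j" arbitrary: i j rule: less_induct)
  case less
  have le: "(\<lambda>S. S $$ (a, b)) \<in> orbit.regular" if "a \<le> b" "b < n" "a + b = i + j" for a b
  proof (cases "essential a b")
    case True
    then have "(a, b) \<in> E" using that(1,2) by (simp add: E_def)
    then show ?thesis by (rule orbit.regular_coord)
  next
    case False
    show ?thesis
    proof (rule regular_inessential_entry[OF that(1,2) False])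
      fix a' b' assume "a' < n" "b' < n" "a' + b' < a + b"
      then show "(\<lambda>S. S $$ (a', b')) \<in> orbit.regular"
        using less.hyps[of a' b'] that(3) by simp
    qed
  qed
  show ?case
  proof (cases "i \<le> j")
    case True
    show ?thesis by (rule le[OF True less.prems(2) refl])
  next
    case False
    then have "(\<lambda>S. S $$ (j, i)) \<in> orbit.regular"
      using le[of j i] less.prems(1) by (simp add: add.commute)
    then show ?thesis
    proof (rule orbit.regular_cong)
      fix S assume "S \<in> congruence_orbit n \<pi>"
      then show "S $$ (j, i) = S $$ (i, j)"
        using sym_mats_index[of S n j i] orbit_subset less.prems by blast
    qed
  qed
qed

lemma poly_funs_regular: "f \<in> poly_funs n \<Longrightarrow> f \<in> orbit.regular"
proof (induction rule: poly_funs.induct)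
  case (entry i j)
  then show ?case by (rule regular_entry)
next
  case (add f g)
  show ?case using add.IH by (rule orbit.regular_add)
next
  case (mult f g)
  show ?case using mult.IH by (rule orbit.regular_mult)
qed (rule orbit.regular_const)

section \<open>Lower bound: a chain of orbit strata\<close>

text \<open>Orders unordered pairs of indices below \<open>n\<close> lexicographically, the smaller
  index first.\<close>

definition pair_key :: "nat \<Rightarrow> nat \<Rightarrow> nat" where
  "pair_key i j = min i j * n + max i j"

lemma pair_key_commute: "pair_key i j = pair_key j i"
  by (simp add: pair_key_def min.commute max.commute)

lemma pair_key_mono:
  assumes "a \<le> i" "b \<le> j"
  shows "pair_key a b \<le> pair_key i j"
  unfolding pair_key_def using assms by (intro add_mono mult_right_mono) auto

lemma inj_on_pair_key: "inj_on (\<lambda>(i, j). pair_key i j) E"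
proof (rule inj_onI, clarify)
  fix i j i' j' assume E: "(i, j) \<in> E" "(i', j') \<in> E" and eq: "pair_key i j = pair_key i' j'"
  have less: "i \<le> j" "j < n" "i' \<le> j'" "j' < n" using E by (auto simp: E_def)
  then have eq: "i * n + j = i' * n + j'" using eq by (simp add: pair_key_def)
  have "(i * n + j) div n = i" "(i * n + j) mod n = j" using less by simp_all
  moreover have "(i' * n + j') div n = i'" "(i' * n + j') mod n = j'" using less by simp_all
  ultimately show "i = i' \<and> j = j'" unfolding eq by simp
qed

text \<open>A one of \<open>\<pi>\<close> at \<open>(a, a')\<close> makes the parameter \<open>B $$ (a, b)\<close> enter the matrix
  \<open>transpose_mat B * \<pi> * B\<close> for the first time at the position \<open>{a', b}\<close>. The parameters entering
  before the key \<open>v\<close> are frozen at their values in the identity matrix.\<close>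

definition frozen :: "nat \<Rightarrow> complex mat set" where
  "frozen v = {B \<in> borel_group n.
     \<forall>a a' b. (a, a') \<in> ones \<and> b < n \<and> pair_key a' b < v \<longrightarrow> B $$ (a, b) = 1\<^sub>m n $$ (a, b)}"

definition stratum :: "nat \<Rightarrow> complex mat set" where
  "stratum v = zariski_sym n closure_of ((\<lambda>B. transpose_mat B * \<pi> * B) ` frozen v)"

lemma frozen_borel: "B \<in> frozen v \<Longrightarrow> B \<in> borel_group n"
  by (simp add: frozen_def)

lemma frozen_carrier: "B \<in> frozen v \<Longrightarrow> B \<in> carrier_mat n n"
  by (simp add: frozen_def borel_group_def)

lemma one_in_frozen: "1\<^sub>m n \<in> frozen v"
  by (auto simp: frozen_def borel_group_iff)

lemma frozen_image_subset: "(\<lambda>B. transpose_mat B * \<pi> * B) ` frozen v \<subseteq> congruence_orbit n \<pi>"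
  unfolding congruence_orbit_def using frozen_borel by blast

lemma stratum_subset: "stratum v \<subseteq> zariski_sym n closure_of congruence_orbit n \<pi>"
  unfolding stratum_def by (rule closure_of_mono[OF frozen_image_subset])

lemma stratum_decreasing: "stratum (Suc v) \<subseteq> stratum v"
proof -
  have "frozen (Suc v) \<subseteq> frozen v" unfolding frozen_def using less_SucI by blast
  then show ?thesis unfolding stratum_def by (intro closure_of_mono image_mono)
qed

lemma closedin_stratum: "closedin (zariski_sym n) (stratum v)"
  unfolding stratum_def by (rule closedin_closure_of)

text \<open>Apart from the nonzero diagonal, the conditions defining \<open>frozen v\<close> are
  affine. Hence the line through two members stays inside wherever \<open>r\<close>, the product of
  the diagonal entries along it, is nonzero.\<close>

lemma irreducible_stratum: "irreducible_in (zariski_sym n) (stratum v)"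
  unfolding stratum_def
proof (rule irreducible_in_closure_image)
  show "frozen v \<noteq> {}" using one_in_frozen by blast
  show "(\<lambda>B. transpose_mat B * \<pi> * B) ` frozen v \<subseteq> sym_mats n"
    using frozen_image_subset orbit_subset by (rule subset_trans)
  fix B B' assume B: "B \<in> frozen v" and B': "B' \<in> frozen v"
  define \<gamma> where "\<gamma> t = mat n n (\<lambda>(i, j). B $$ (i, j) + t * (B' $$ (i, j) - B $$ (i, j)))" for t :: complex
  define q where "q i j = [:B $$ (i, j), B' $$ (i, j) - B $$ (i, j):]" for i j
  define r where "r = (\<Prod>i<n. q i i)"
  have \<gamma>_q: "\<gamma> t $$ (i, j) = poly (q i j) t" if "i < n" "j < n" for i j t
    using that by (simp add: \<gamma>_def q_def)
  have \<gamma>_carrier: "\<gamma> t \<in> carrier_mat n n" for t by (simp add: \<gamma>_def)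
  have poly_r: "poly r t = (\<Prod>i<n. \<gamma> t $$ (i, i))" for t
    unfolding r_def by (simp add: poly_prod \<gamma>_q)
  have \<gamma>0: "\<gamma> 0 = B" and \<gamma>1: "\<gamma> 1 = B'"
    using frozen_carrier[OF B] frozen_carrier[OF B'] by (auto simp: \<gamma>_def intro!: eq_matI)
  have "poly r 0 \<noteq> 0"
    using frozen_borel[OF B] unfolding poly_r \<gamma>0 by (simp add: borel_group_iff)
  then have "r \<noteq> 0" by auto
  moreover have "\<gamma> t \<in> frozen v" if t: "poly r t \<noteq> 0" for t
  proof -
    have "\<gamma> t $$ (i, i) \<noteq> 0" if "i < n" for i using t that unfolding poly_r by simp
    moreover have "\<gamma> t $$ (i, j) = 0" if "i < n" "j < i" for i j
      using that frozen_borel[OF B] frozen_borel[OF B'] by (simp add: \<gamma>_def borel_group_iff)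
    ultimately have "\<gamma> t \<in> borel_group n" using \<gamma>_carrier by (simp add: borel_group_iff)
    moreover have "\<gamma> t $$ (a, b) = 1\<^sub>m n $$ (a, b)"
      if a: "(a, a') \<in> ones" and b: "b < n" and key: "pair_key a' b < v" for a a' b
    proof -
      have "B $$ (a, b) = 1\<^sub>m n $$ (a, b)" "B' $$ (a, b) = 1\<^sub>m n $$ (a, b)"
        using B B' a b key unfolding frozen_def by blast+
      then show ?thesis using ones_less[OF a] b by (simp add: \<gamma>_def)
    qed
    ultimately show ?thesis unfolding frozen_def by blast
  qed
  moreover have "\<exists>p. \<forall>t. (transpose_mat (\<gamma> t) * \<pi> * \<gamma> t) $$ (i, j) = poly p t" if ij: "i < n" "j < n" for i j
  proof (intro exI allI)
    fix t
    have "(transpose_mat (\<gamma> t) * \<pi> * \<gamma> t) $$ (i, j) = (\<Sum>(a, b)\<in>ones. \<gamma> t $$ (a, i) * \<gamma> t $$ (b, j))"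
      by (rule congruence_index[OF \<gamma>_carrier ij])
    also have "\<dots> = (\<Sum>x\<in>ones. poly (q (fst x) i * q (snd x) j) t)"
      using \<gamma>_q ij ones_less by (intro sum.cong) auto
    finally show "(transpose_mat (\<gamma> t) * \<pi> * \<gamma> t) $$ (i, j) = poly (\<Sum>x\<in>ones. q (fst x) i * q (snd x) j) t"
      by (simp only: poly_sum)
  qed
  ultimately have "r \<noteq> 0 \<and> (\<forall>t. poly r t \<noteq> 0 \<longrightarrow> \<gamma> t \<in> frozen v) \<and> \<gamma> 0 = B \<and> \<gamma> 1 = B' \<and>
      (\<forall>i<n. \<forall>j<n. \<exists>p. \<forall>t. (transpose_mat (\<gamma> t) * \<pi> * \<gamma> t) $$ (i, j) = poly p t)"
    using \<gamma>0 \<gamma>1 by simp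
  then show "\<exists>\<gamma> r. r \<noteq> 0 \<and> (\<forall>t::complex. poly r t \<noteq> 0 \<longrightarrow> \<gamma> t \<in> frozen v) \<and> \<gamma> 0 = B \<and> \<gamma> 1 = B' \<and>
      (\<forall>i<n. \<forall>j<n. \<exists>p. \<forall>t. (transpose_mat (\<gamma> t) * \<pi> * \<gamma> t) $$ (i, j) = poly p t)"
    by (intro exI)
qed

text \<open>Each summand of the entry either vanishes by triangularity, for \<open>B\<close> as for
  the identity matrix, or has both factors frozen at their values in the identity matrix.\<close>

lemma frozen_entry:
  assumes B: "B \<in> frozen (Suc (pair_key i j))" and ij: "i < n" "j < n"
  shows "(transpose_mat B * \<pi> * B) $$ (i, j) = \<pi> $$ (i, j)"
proof -
  have low: "\<And>a c. a < n \<Longrightarrow> c < a \<Longrightarrow> B $$ (a, c) = 0"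
    using frozen_borel[OF B] by (simp add: borel_group_iff)
  have fix1: "B $$ (a, c) = 1\<^sub>m n $$ (a, c)" if "(a, a') \<in> ones" "c < n" "pair_key a' c \<le> pair_key i j" for a a' c
  proof -
    have "pair_key a' c < Suc (pair_key i j)" using that(3) by simp
    then show ?thesis using B that(1,2) unfolding frozen_def by blast
  qed
  have "(transpose_mat B * \<pi> * B) $$ (i, j) = (\<Sum>(a, b)\<in>ones. B $$ (a, i) * B $$ (b, j))"
    by (rule congruence_index[OF frozen_carrier[OF B] ij])
  also have "\<dots> = (\<Sum>(a, b)\<in>ones. 1\<^sub>m n $$ (a, i) * 1\<^sub>m n $$ (b, j))"
  proof (rule sum.cong, rule refl, clarify)
    fix a b assume ab: "(a, b) \<in> ones"
    have less: "a < n" "b < n" using ones_less[OF ab] by auto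
    consider "i < a" | "j < b" | "a \<le> i" "b \<le> j" by linarith
    then show "B $$ (a, i) * B $$ (b, j) = 1\<^sub>m n $$ (a, i) * 1\<^sub>m n $$ (b, j)"
    proof cases
      case 1
      then show ?thesis using low less ij by simp
    next
      case 2
      then show ?thesis using low less ij by simp
    next
      case 3
      \<comment> \<open>The one at \<open>(a, b)\<close> gives \<open>B $$ (a, i)\<close> the key
        \<open>pair_key b i\<close>; its mirror image at \<open>(b, a)\<close> gives
        \<open>B $$ (b, j)\<close> the key \<open>pair_key a j\<close>.\<close>
      have "pair_key b i \<le> pair_key i j"
        using pair_key_mono[OF order_refl 3(2), of i] by (simp add: pair_key_commute)
      then have "B $$ (a, i) = 1\<^sub>m n $$ (a, i)" using ab ij by (intro fix1[of a b])
      moreover have "B $$ (b, j) = 1\<^sub>m n $$ (b, j)"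
        using ones_sym[OF ab] ij pair_key_mono[OF 3(1) order_refl, of j] by (intro fix1[of b a])
      ultimately show ?thesis by simp
    qed
  qed
  also have "\<dots> = (transpose_mat (1\<^sub>m n) * \<pi> * 1\<^sub>m n) $$ (i, j)"
    by (rule congruence_index[symmetric, OF one_carrier_mat ij])
  also have "\<dots> = \<pi> $$ (i, j)" using pi_carrier by simp
  finally show ?thesis .
qed

text \<open>The witness is the identity matrix with 1 added at the still free position
  \<open>(x, y)\<close>. By \<open>hit\<close> this position is a factor of some summand, and the
  growth of that summand cannot be cancelled, since all summands are natural numbers.\<close>

lemma unfrozen_entry:
  assumes xy: "x \<le> y" "y < n" and x: "(x, x') \<in> ones" and key: "pair_key x' y = pair_key i j"
    and ij: "i < n" "j < n" and hit: "(a, b) \<in> ones" "a = x \<and> i = y \<and> b = j \<or> a = i \<and> b = x \<and> j = y"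
    and ord: "i \<le> j"
  shows "\<exists>B\<in>frozen (pair_key i j). (transpose_mat B * \<pi> * B) $$ (i, j) \<noteq> \<pi> $$ (i, j)"
proof -
  \<comment> \<open>For \<open>x = y\<close> the diagonal entry becomes 2, which keeps the matrix
    invertible.\<close>
  define \<beta> :: "nat \<Rightarrow> nat \<Rightarrow> nat" where "\<beta> p q = of_bool (p = q) + of_bool (p = x \<and> q = y)" for p q
  define B where "B = mat n n (\<lambda>(p, q). of_nat (\<beta> p q) :: complex)"
  have B: "B \<in> carrier_mat n n" by (simp add: B_def)
  have "B \<in> borel_group n"
    unfolding borel_group_iff
  proof (intro conjI allI impI B)
    show "B $$ (p, q) = 0" if "p < n" "q < p" for p q
      using that xy by (auto simp: B_def \<beta>_def)
    show "B $$ (p, p) \<noteq> 0" if "p < n" for p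
    proof -
      have "\<beta> p p \<noteq> 0" by (simp add: \<beta>_def)
      then show ?thesis using that by (simp add: B_def)
    qed
  qed
  moreover have "B $$ (p, q) = 1\<^sub>m n $$ (p, q)"
    if p: "(p, p') \<in> ones" and q: "q < n" and less: "pair_key p' q < pair_key i j" for p p' q
  proof -
    have "\<not> (p = x \<and> q = y)"
    proof
      assume "p = x \<and> q = y"
      then have "pair_key p' q = pair_key x' y" using ones_fun[OF x, of p'] p by simp
      then show False using less key by simp
    qed
    then show ?thesis using ones_less[OF p] q by (auto simp: B_def \<beta>_def)
  qed
  ultimately have "B \<in> frozen (pair_key i j)" unfolding frozen_def by blast
  moreover have "(transpose_mat B * \<pi> * B) $$ (i, j) \<noteq> \<pi> $$ (i, j)"
  proof -
    have "(transpose_mat B * \<pi> * B) $$ (i, j) = (\<Sum>(p, q)\<in>ones. B $$ (p, i) * B $$ (q, j))"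
      by (rule congruence_index[OF B ij])
    also have "\<dots> = of_nat (\<Sum>(p, q)\<in>ones. \<beta> p i * \<beta> q j)"
      unfolding of_nat_sum
    proof (rule sum.cong, rule refl, clarify)
      fix p q assume "(p, q) \<in> ones"
      from ones_less[OF this] show "B $$ (p, i) * B $$ (q, j) = of_nat (\<beta> p i * \<beta> q j)"
        using ij by (simp add: B_def)
    qed
    finally have L: "(transpose_mat B * \<pi> * B) $$ (i, j) = of_nat (\<Sum>(p, q)\<in>ones. \<beta> p i * \<beta> q j)" .
    have "\<pi> $$ (i, j) = (transpose_mat (1\<^sub>m n) * \<pi> * 1\<^sub>m n) $$ (i, j)" using pi_carrier by simp
    also have "\<dots> = (\<Sum>(p, q)\<in>ones. 1\<^sub>m n $$ (p, i) * 1\<^sub>m n $$ (q, j))"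
      by (rule congruence_index[OF one_carrier_mat ij])
    also have "\<dots> = of_nat (\<Sum>(p, q)\<in>ones. of_bool (p = i) * of_bool (q = j))"
      unfolding of_nat_sum
    proof (rule sum.cong, rule refl, clarify)
      fix p q assume "(p, q) \<in> ones"
      from ones_less[OF this] show "1\<^sub>m n $$ (p, i) * 1\<^sub>m n $$ (q, j) = of_nat (of_bool (p = i) * of_bool (q = j))"
        using ij by simp
    qed
    finally have R: "\<pi> $$ (i, j) = of_nat (\<Sum>(p, q)\<in>ones. of_bool (p = i) * of_bool (q = j))" .
    have "(\<Sum>(p, q)\<in>ones. of_bool (p = i) * of_bool (q = j)) < (\<Sum>(p, q)\<in>ones. \<beta> p i * \<beta> q j)"
    proof (rule sum_strict_mono_ex1[OF finite_ones])
      show "\<forall>z\<in>ones. (case z of (p, q) \<Rightarrow> of_bool (p = i) * of_bool (q = j)) \<le> (case z of (p, q) \<Rightarrow> \<beta> p i * \<beta> q j)"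
        by (auto simp: \<beta>_def)
      show "\<exists>z\<in>ones. (case z of (p, q) \<Rightarrow> of_bool (p = i) * of_bool (q = j)) < (case z of (p, q) \<Rightarrow> \<beta> p i * \<beta> q j)"
        by (rule bexI[OF _ hit(1)]) (use hit(2) in \<open>auto simp: \<beta>_def\<close>)
    qed
    then show ?thesis unfolding L R of_nat_eq_iff by simp
  qed
  ultimately show ?thesis by blast
qed

text \<open>The entry \<open>(i, j)\<close> is constant on the smaller stratum, but the larger one
  contains a matrix where it has another value.\<close>

lemma stratum_strict:
  assumes E: "(i, j) \<in> E"
  shows "stratum (Suc (pair_key i j)) \<noteq> stratum (pair_key i j)"
proof -
  have ij: "i \<le> j" "j < n" "i < n" and ess: "essential i j" using E by (auto simp: E_def)
  have "\<exists>B\<in>frozen (pair_key i j). (transpose_mat B * \<pi> * B) $$ (i, j) \<noteq> \<pi> $$ (i, j)"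
    using ess unfolding essential_def
  proof (elim disjE exE conjE)
    \<comment> \<open>For a one in row \<open>i\<close> the varied parameter is at
      \<open>(b, j)\<close>; for a one in column \<open>j\<close> it is at
      \<open>(a, i)\<close>.\<close>
    fix b assume b: "b \<le> j" "(i, b) \<in> ones"
    show ?thesis
      by (rule unfrozen_entry[OF b(1) ij(2) ones_sym[OF b(2)] refl ij(3,2) b(2) _ ij(1)]) simp
  next
    fix a assume a: "a \<le> i" "(a, j) \<in> ones"
    show ?thesis
      by (rule unfrozen_entry[OF a(1) ij(3) a(2) pair_key_commute ij(3,2) a(2) _ ij(1)]) simp
  qed
  then obtain B where B: "B \<in> frozen (pair_key i j)" "(transpose_mat B * \<pi> * B) $$ (i, j) \<noteq> \<pi> $$ (i, j)"
    by blast
  have poly: "(\<lambda>A. A $$ (i, j) + - \<pi> $$ (i, j)) \<in> poly_funs n"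
    using ij by (intro poly_funs.intros)
  have "A $$ (i, j) + - \<pi> $$ (i, j) = 0" if "A \<in> stratum (Suc (pair_key i j))" for A
  proof (rule vanishing_on_closure[OF subset_trans[OF frozen_image_subset orbit_subset] poly])
    show "A \<in> zariski_sym n closure_of ((\<lambda>B. transpose_mat B * \<pi> * B) ` frozen (Suc (pair_key i j)))"
      using that by (simp add: stratum_def)
    show "C $$ (i, j) + - \<pi> $$ (i, j) = 0"
      if C: "C \<in> (\<lambda>B. transpose_mat B * \<pi> * B) ` frozen (Suc (pair_key i j))" for C
    proof -
      obtain B where "B \<in> frozen (Suc (pair_key i j))" "C = transpose_mat B * \<pi> * B" using C by blast
      then show ?thesis using frozen_entry[of B i j] ij by simp
    qed
  qed
  from this[of "transpose_mat B * \<pi> * B"] B(2)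
  have "transpose_mat B * \<pi> * B \<notin> stratum (Suc (pair_key i j))"
    unfolding add_eq_0_iff2 minus_minus by blast
  moreover have "transpose_mat B * \<pi> * B \<in> stratum (pair_key i j)"
  proof -
    have "(\<lambda>B. transpose_mat B * \<pi> * B) ` frozen (pair_key i j) \<subseteq> stratum (pair_key i j)"
      unfolding stratum_def using subset_trans[OF frozen_image_subset orbit_subset]
      by (intro closure_of_subset) (simp add: topspace_zariski_sym)
    then show ?thesis using B(1) by blast
  qed
  ultimately show ?thesis by blast
qed

text \<open>Distinct essential positions have distinct keys, so the strata drop strictly at
  \<open>card E\<close> indices and yield a chain of that length; \<open>chain_length_le\<close>
  excludes longer ones.\<close>

lemma krull_dim_closure_orbit:
  "krull_dim (subtopology (zariski_sym n) (zariski_sym n closure_of congruence_orbit n \<pi>)) = enat (card E)"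
proof -
  let ?K = "(\<lambda>(i, j). pair_key i j) ` E"
  have card_K: "card ?K = card E" by (rule card_image[OF inj_on_pair_key])
  have "stratum (Suc v) \<noteq> stratum v" if v: "v \<in> ?K" for v
  proof -
    obtain i j where "(i, j) \<in> E" "v = pair_key i j" using v by auto
    then show ?thesis using stratum_strict by simp
  qed
  from chain_of_decreasing_family[of ?K stratum, OF finite_imageI[OF finite_E] stratum_decreasing this]
  obtain Z where Z': "(\<forall>i\<le>card E. Z i \<in> range stratum) \<and> (\<forall>i<card E. Z i \<subset> Z (Suc i))"
    unfolding card_K ..
  then have Z: "\<And>i. i \<le> card E \<Longrightarrow> Z i \<in> range stratum" "\<And>i. i < card E \<Longrightarrow> Z i \<subset> Z (Suc i)"
    by simp_all
  show ?thesis
  proof (rule krull_dim_closed_subtopology[of _ _ _ Z])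
    show "closedin (zariski_sym n) (zariski_sym n closure_of congruence_orbit n \<pi>)"
      by (rule closedin_closure_of)
    show "m \<le> card E"
      if "\<And>i. i \<le> m \<Longrightarrow> closedin (zariski_sym n) (Z i) \<and> irreducible_in (zariski_sym n) (Z i)"
        "\<And>i. i < m \<Longrightarrow> Z i \<subset> Z (Suc i)" "Z m \<subseteq> zariski_sym n closure_of congruence_orbit n \<pi>"
      for m Z
      by (rule chain_length_le[OF orbit_subset orbit.coordinates_axioms poly_funs_regular that])
    show "closedin (zariski_sym n) (Z i) \<and> irreducible_in (zariski_sym n) (Z i) \<and>
        Z i \<subseteq> zariski_sym n closure_of congruence_orbit n \<pi>" if i: "i \<le> card E" for i
    proof -
      obtain v where "Z i = stratum v" using Z(1)[OF i] by blast
      then show ?thesis using closedin_stratum irreducible_stratum stratum_subset by simp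
    qed
    show "Z i \<subset> Z (Suc i)" if "i < card E" for i using Z(2)[OF that] .
  qed
qed

end

theorem theorem7p4:
  fixes n :: nat and \<pi> :: "complex mat"
  assumes "partial_involution n \<pi>"
  shows "ereal_of_enat
           (krull_dim (subtopology (zariski_sym n) (zariski_sym n closure_of congruence_orbit n \<pi>)))
         = ereal ((real n ^ 2 + real n) / 2 - real (diag_repeats n \<pi>))"
proof -
  interpret partial_inv n \<pi> by unfold_locales (rule assms)
  show ?thesis by (simp add: krull_dim_closure_orbit card_E)
qed

end
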